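(* Fix $i\in\{1,\dots,L\}$, $\mathbf{G}\in\mathbb{C}^{M\times K}$ with $\mathbf{g}=\mathrm{vec}(\mathbf{G})$, and vectors $\mathbf{f}_j\in\mathbb{C}^{J_jN_j}$ for $j\ne i$. Assume $\mathbf{K}_i\mathbf{\Sigma}_{\mathbf{s}}\mathbf{K}_i^H\succ 0$ or $\mathbf{\Sigma}_i\succ 0$. Consider the problem $$(\mathsf{P}2_i'):\quad \min_{\mathbf{f}_i\in\mathbb{C}^{J_iN_i}}\ \mathbf{f}_i^H(\mathbf{A}_{ii}+\mathbf{C}_i)\mathbf{f}_i+2\,\mathrm{Re}\{\mathbf{q}_i^H\mathbf{f}_i\}-2\,\mathrm{Re}\{\mathbf{g}^H\mathbf{B}_i\mathbf{f}_i\}\quad\text{s.t.}\quad \mathbf{f}_i^H\mathbf{E}_i\mathbf{f}_i\le P_i,$$ where $\mathbf{A}_{ii},\mathbf{B}_i,\mathbf{C}_i,\mathbf{E}_i,\mathbf{q}_i$ and also $\mathbf{M}_i,\lambda_{i,k},r_i,\mathbf{p}_i=(p_{i,k})_k$ are as defined in the context. Then: CASE (I): Suppose that either i) there exists $k\in\{r_i+1,\dots,J_iN_i\}$ with $|p_{i,k}|\ne 0$; or ii) $\sum_{k=r_i+1}^{J_iN_i}|p_{i,k}|=0$ and $\sum_{k=1}^{r_i}\frac{|p_{i,k}|^2}{\lambda_{i,k}^2}>P_i$. Then the equation $$g_i(\mu_i)=\sum_{k=1}^{J_iN_i}\frac{|p_{i,k}|^2}{(\lambda_{i,k}+\mu_i)^2}=P_i$$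 has a unique positive solution $\mu_i^\star$, and the optimal solution to $(\mathsf{P}2_i')$ is $$\mathbf{f}_i^\star=\big(\mathbf{A}_{ii}+\mathbf{C}_i+\mu_i^\star\mathbf{E}_i\big)^{-1}\big(\mathbf{B}_i^H\mathbf{g}-\mathbf{q}_i\big).$$ Moreover $\mu_i^\star\in[lbd_i,ubd_i]$, where $lbd_i=\max\{0,\|\mathbf{p}_i\|_2/\sqrt{P_i}-\lambda_{i,1}\}$, and $ubd_i=\|\mathbf{p}_i\|_2/\sqrt{P_i}$ in subcase i), $ubd_i=\|\mathbf{p}_i\|_2/\sqrt{P_i}-\lambda_{i,r_i}$ in subcase ii). CASE (II): Suppose that $\sum_{k=r_i+1}^{J_iN_i}|p_{i,k}|=0$ and $\sum_{k=1}^{r_i}\frac{|p_{i,k}|^2}{\lambda_{i,k}^2}\le P_i$. Then an optimal solution to $(\mathsf{P}2_i')$ is $$\mathbf{f}_i^\star=\mathbf{E}_i^{-\frac12}\Big(\mathbf{E}_i^{-\frac12}(\mathbf{A}_{ii}+\mathbf{C}_i)\mathbf{E}_i^{-\frac12}\Big)^{\dagger}\mathbf{E}_i^{-\frac12}\big(\mathbf{B}_i^H\mathbf{g}-\mathbf{q}_i\big),$$ where $^\dagger$ denotes the Moore–Penrose pseudoinverse.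
   Context: Positive integers $L,M,K$ and $N_j,J_j$ ($j=1,\dots,L$) are given, together with complex matrices $\mathbf{K}_j\in\mathbb{C}^{J_j\times K}$, $\mathbf{H}_j\in\mathbb{C}^{M\times N_j}$, Hermitian positive semidefinite (covariance) matrices $\mathbf{\Sigma}_{\mathbf{s}}\in\mathbb{C}^{K\times K}$ and $\mathbf{\Sigma}_j\in\mathbb{C}^{J_j\times J_j}$, and reals $P_j>0$. $\mathrm{vec}$ stacks the columns of a matrix, $\otimes$ is the Kronecker product, $^*$ is entrywise conjugation, $^T$ transpose, $^H$ conjugate transpose, $\succ 0$ means Hermitian positive definite. Definitions: $$\mathbf{A}_{ij}=(\mathbf{K}_j\mathbf{\Sigma}_{\mathbf{s}}\mathbf{K}_i^H)^T\otimes(\mathbf{H}_i^H\mathbf{G}\mathbf{G}^H\mathbf{H}_j),\quad \mathbf{B}_i=(\mathbf{K}_i\mathbf{\Sigma}_{\mathbf{s}})^T\otimes\mathbf{H}_i,\quad \mathbf{C}_i=\mathbf{\Sigma}_i^*\otimes(\mathbf{H}_i^H\mathbf{G}\mathbf{G}^H\mathbf{H}_i),$$ $$\mathbf{E}_i=(\mathbf{K}_i\mathbf{\Sigma}_{\mathbf{s}}\mathbf{K}_i^H+\mathbf{\Sigma}_i)^T\otimes\mathbf{I}_{N_i},\quad \mathbf{q}_i=\sum_{j=1,\,j\ne i}^L\mathbf{A}_{ij}\mathbf{f}_j.$$ Under the positive definiteness assumption $\mathbf{E}_i\succ0$; $\mathbf{E}_i^{1/2}$ is its Hermitian positive definite square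 root. Let $$\mathbf{M}_i=\mathbf{E}_i^{-\frac12}(\mathbf{A}_{ii}+\mathbf{C}_i)\mathbf{E}_i^{-\frac12}=\mathbf{U}_i\mathbf{\Lambda}_i\mathbf{U}_i^H$$ be an eigenvalue decomposition ($\mathbf{U}_i$ unitary, $\mathbf{\Lambda}_i$ diagonal) of the Hermitian positive semidefinite matrix $\mathbf{M}_i$, with eigenvalues $\lambda_{i,k}=[\mathbf{\Lambda}_i]_{k,k}$ in decreasing order; let $r_i$ be the rank of $\mathbf{M}_i$, so $\lambda_{i,1}\ge\dots\ge\lambda_{i,r_i}>\lambda_{i,r_i+1}=\dots=\lambda_{i,J_iN_i}=0$. Let $\mathbf{p}_i=\mathbf{U}_i^H\mathbf{E}_i^{-\frac12}(\mathbf{B}_i^H\mathbf{g}-\mathbf{q}_i)\in\mathbb{C}^{J_iN_i}$ and let $p_{i,k}$ be its $k$-th entry. *)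

theory Defs
  imports
    "HOL-Analysis.L2_Norm"
    "Jordan_Normal_Form.Schur_Decomposition"
    "Jordan_Normal_Form.Gauss_Jordan_Elimination"
    "Jordan_Normal_Form.DL_Rank"
begin

text \<open>
  Conventions: the inner product \<open>x\<^sup>H y\<close> is \<open>conjugate x \<bullet> y\<close>, the conjugate
  transpose is \<^const>\<open>mat_adjoint\<close>, and matrix and vector entries are indexed from 0.
\<close>

definition kronecker :: "complex mat \<Rightarrow> complex mat \<Rightarrow> complex mat" where
  "kronecker A B =
     mat (dim_row A * dim_row B) (dim_col A * dim_col B)
       (\<lambda>(a, b). A $$ (a div dim_row B, b div dim_col B) * B $$ (a mod dim_row B, b mod dim_col B))"

text \<open>Column stacking: entry \<open>(a, b)\<close> goes to position \<open>a + b * dim_row A\<close>.\<close>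

definition vectorize :: "complex mat \<Rightarrow> complex vec" where
  "vectorize A = vec (dim_row A * dim_col A) (\<lambda>k. A $$ (k mod dim_row A, k div dim_row A))"

definition hermitian_mat :: "complex mat \<Rightarrow> bool" where
  "hermitian_mat A \<longleftrightarrow> mat_adjoint A = A"

text \<open>The quadratic form of a Hermitian matrix is real, so \<^const>\<open>Re\<close> loses nothing here.\<close>

definition psd_mat :: "complex mat \<Rightarrow> bool" where
  "psd_mat A \<longleftrightarrow> hermitian_mat A \<and>
     (\<forall>v \<in> carrier_vec (dim_row A). 0 \<le> Re (conjugate v \<bullet> (A *\<^sub>v v)))"

definition pd_mat :: "complex mat \<Rightarrow> bool" where
  "pd_mat A \<longleftrightarrow> hermitian_mat A \<and>
     (\<forall>v \<in> carrier_vec (dim_row A). v \<noteq> 0\<^sub>v (dim_row A) \<longrightarrow> 0 < Re (conjugate v \<bullet> (A *\<^sub>v v)))"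

definition unitary_mat :: "complex mat \<Rightarrow> bool" where
  "unitary_mat U \<longleftrightarrow> inverts_mat U (mat_adjoint U) \<and> inverts_mat (mat_adjoint U) U"

text \<open>Unspecified unless \<open>A\<close> is square and invertible.\<close>

definition mat_inv :: "complex mat \<Rightarrow> complex mat" where
  "mat_inv A = the (mat_inverse A)"

text \<open>The positive definite square root; unspecified unless \<open>A\<close> is positive definite.\<close>

definition pd_sqrt :: "complex mat \<Rightarrow> complex mat" where
  "pd_sqrt A = (THE R. R \<in> carrier_mat (dim_row A) (dim_row A) \<and> pd_mat R \<and> R * R = A)"

text \<open>The Moore-Penrose pseudoinverse, given by the four Penrose equations.\<close>

definition pinv :: "complex mat \<Rightarrow> complex mat" where
  "pinv A = (THE X. X \<in> carrier_mat (dim_col A) (dim_row A) \<and>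
     A * X * A = A \<and> X * A * X = X \<and> hermitian_mat (A * X) \<and> hermitian_mat (X * A))"

text \<open>
  In the following, \<open>Km j\<close>, \<open>Hm j\<close>, \<open>Sig j\<close> are the matrices \<open>K\<^sub>j\<close>, \<open>H\<^sub>j\<close>, \<open>\<Sigma>\<^sub>j\<close>,
  and \<open>Sigs\<close> is the source covariance.
\<close>

definition matA ::
  "(nat \<Rightarrow> complex mat) \<Rightarrow> complex mat \<Rightarrow> (nat \<Rightarrow> complex mat) \<Rightarrow> complex mat \<Rightarrow> nat \<Rightarrow> nat \<Rightarrow> complex mat"
  where
  "matA Km Sigs Hm G i j =
     kronecker (transpose_mat (Km j * Sigs * mat_adjoint (Km i)))
               (mat_adjoint (Hm i) * G * mat_adjoint G * Hm j)"

definition matB ::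
  "(nat \<Rightarrow> complex mat) \<Rightarrow> complex mat \<Rightarrow> (nat \<Rightarrow> complex mat) \<Rightarrow> nat \<Rightarrow> complex mat" where
  "matB Km Sigs Hm i = kronecker (transpose_mat (Km i * Sigs)) (Hm i)"

definition matC ::
  "(nat \<Rightarrow> complex mat) \<Rightarrow> (nat \<Rightarrow> complex mat) \<Rightarrow> complex mat \<Rightarrow> nat \<Rightarrow> complex mat" where
  "matC Sig Hm G i =
     kronecker (map_mat cnj (Sig i)) (mat_adjoint (Hm i) * G * mat_adjoint G * Hm i)"

definition matE ::
  "(nat \<Rightarrow> complex mat) \<Rightarrow> complex mat \<Rightarrow> (nat \<Rightarrow> complex mat) \<Rightarrow> (nat \<Rightarrow> nat) \<Rightarrow> nat \<Rightarrow> complex mat"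
  where
  "matE Km Sigs Sig N i =
     kronecker (transpose_mat (Km i * Sigs * mat_adjoint (Km i) + Sig i)) (1\<^sub>m (N i))"

text \<open>\<^const>\<open>finsum_vec\<close> is the sum in the space of vectors of dimension \<open>J i * N i\<close>.\<close>

definition vecq ::
  "nat \<Rightarrow> (nat \<Rightarrow> nat) \<Rightarrow> (nat \<Rightarrow> nat) \<Rightarrow> (nat \<Rightarrow> complex mat) \<Rightarrow> complex mat \<Rightarrow>
   (nat \<Rightarrow> complex mat) \<Rightarrow> complex mat \<Rightarrow> (nat \<Rightarrow> complex vec) \<Rightarrow> nat \<Rightarrow> complex vec" where
  "vecq L J N Km Sigs Hm G f i =
     finsum_vec TYPE(complex) (J i * N i)
       (\<lambda>j. matA Km Sigs Hm G i j *\<^sub>v f j) ({1..L} - {i})"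

text \<open>
  Objective and constraint of the problem in the variable \<open>x\<close>. The quadratic forms are real for
  the Hermitian \<open>Q\<close> and \<open>E\<close> to which they are applied.
\<close>

definition P2_objective ::
  "complex mat \<Rightarrow> complex mat \<Rightarrow> complex vec \<Rightarrow> complex vec \<Rightarrow> complex vec \<Rightarrow> real" where
  "P2_objective Q B q g x =
     Re (conjugate x \<bullet> (Q *\<^sub>v x)) + 2 * Re (conjugate q \<bullet> x) - 2 * Re (conjugate g \<bullet> (B *\<^sub>v x))"

definition P2_feasible :: "complex mat \<Rightarrow> real \<Rightarrow> complex vec \<Rightarrow> bool" where
  "P2_feasible E P x \<longleftrightarrow> x \<in> carrier_vec (dim_col E) \<and> Re (conjugate x \<bullet> (E *\<^sub>v x)) \<le> P"

end

theory Submission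
  imports Defs "Jordan_Normal_Form.Spectral_Radius"
begin

text \<open>
  Put \<open>S = E\<^sup>-\<^sup>1\<^sup>/\<^sup>2\<close> and \<open>T = S U\<close>. Then \<open>T\<^sup>H E T = I\<close> and \<open>T\<^sup>H Q T = \<Lambda>\<close>, so with \<open>x = T y\<close> the
  problem becomes: minimize \<open>\<Sum> (\<lambda>\<^sub>k |y\<^sub>k|\<^sup>2 - 2 Re (p\<^sub>k\<^sup>* y\<^sub>k))\<close> subject to \<open>\<Sum> |y\<^sub>k|\<^sup>2 \<le> P\<close>. For \<open>\<mu> > 0\<close>
  completing the square exhibits \<open>y\<^sub>k = p\<^sub>k / (\<lambda>\<^sub>k + \<mu>)\<close> as the unique minimizer of the Lagrangian, hence
  as the unique solution as soon as it satisfies the constraint with equality, which is the secular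
  equation for \<open>\<mu>\<close>. Its left-hand side is continuous and strictly decreasing, and replacing all \<open>\<lambda>\<^sub>k\<close>
  by the largest or the smallest relevant one gives the bounds. In case (II) the unconstrained
  minimizer is feasible.
\<close>

section \<open>Hermitian forms and Kronecker products\<close>

text \<open>The square root and the pseudoinverse are defined by definite descriptions, so neither
  can be used before existence and uniqueness are proved. Existence of the root comes from the
  spectral theorem for Hermitian matrices, while the eigendecomposition of \<open>Mi\<close> itself
  is given. The rank \<open>r\<close> is the dimension of a column space and has to be identified
  with the number of nonzero \<open>lam k\<close>. That \<open>Q\<close> is positive semidefinite
  and \<open>E\<close> positive definite rests on their second Kronecker factors being Gram
  matrices: H^H G G^H H is Y^H Y for Y = G^H H, and the identity is its own Gram matrix. Comparing
  objective values through a sum of squares gives existence and uniqueness of the minimizer at once,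
  with no appeal to compactness or to multiplier theory.\<close>

lemma dim_mat_adjoint [simp]:
  "dim_row (mat_adjoint A) = dim_col A" "dim_col (mat_adjoint A) = dim_row A"
  by (simp_all add: mat_adjoint_def)

lemma mat_adjoint_carrier [simp]: "mat_adjoint A \<in> carrier_mat n m \<longleftrightarrow> A \<in> carrier_mat m n"
  by (metis carrier_matD carrier_matI dim_mat_adjoint)

lemma index_mat_adjoint [simp]:
  "i < dim_col A \<Longrightarrow> j < dim_row A \<Longrightarrow> mat_adjoint A $$ (i, j) = conjugate (A $$ (j, i))"
  by (simp add: mat_adjoint_def mat_of_rows_def)

lemma mat_adjoint_mat_adjoint [simp]: "mat_adjoint (mat_adjoint A) = A"
  by (rule eq_matI) auto

lemma mat_adjoint_mult:
  fixes A B :: "complex mat"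
  assumes "A \<in> carrier_mat n m" "B \<in> carrier_mat m k"
  shows "mat_adjoint (A * B) = mat_adjoint B * mat_adjoint A"
  using assms by (intro eq_matI) (auto simp: scalar_prod_def sum_distrib_left mult.commute intro!: sum.cong)

lemma mat_adjoint_add:
  fixes A B :: "complex mat"
  assumes "A \<in> carrier_mat n m" "B \<in> carrier_mat n m"
  shows "mat_adjoint (A + B) = mat_adjoint A + mat_adjoint B"
  using assms by (intro eq_matI) auto

lemma mat_adjoint_one [simp]: "mat_adjoint (1\<^sub>m n :: complex mat) = 1\<^sub>m n"
  by (rule eq_matI) auto

lemma conjugate_scalar_prod_mult_mat:
  fixes A :: "complex mat"
  assumes "A \<in> carrier_mat n m" "x \<in> carrier_vec n" "y \<in> carrier_vec m"
  shows "conjugate x \<bullet> (A *\<^sub>v y) = conjugate (mat_adjoint A *\<^sub>v x) \<bullet> y"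
proof -
  have "conjugate x \<bullet> (A *\<^sub>v y) = (\<Sum>a<n. \<Sum>b<m. cnj (x $ a) * A $$ (a, b) * y $ b)"
    using assms by (auto simp: scalar_prod_def atLeast0LessThan sum_distrib_left mult.assoc intro!: sum.cong)
  also have "\<dots> = (\<Sum>b<m. \<Sum>a<n. cnj (x $ a) * A $$ (a, b) * y $ b)"
    by (rule sum.swap)
  also have "\<dots> = conjugate (mat_adjoint A *\<^sub>v x) \<bullet> y"
    using assms
    by (auto simp: scalar_prod_def atLeast0LessThan sum_distrib_left sum_distrib_right mult_ac intro!: sum.cong)
  finally show ?thesis .
qed

lemma quadratic_form_eq_sum:
  fixes A :: "complex mat"
  assumes "A \<in> carrier_mat n n" "v \<in> carrier_vec n"
  shows "conjugate v \<bullet> (A *\<^sub>v v) = (\<Sum>a<n. \<Sum>b<n. cnj (v $ a) * A $$ (a, b) * v $ b)"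
  using assms by (auto simp: scalar_prod_def atLeast0LessThan sum_distrib_left mult.assoc intro!: sum.cong)

text \<open>This is the substitution x = X y. It serves both the reduction to diagonal form and the
  transport of definiteness along congruences.\<close>

lemma quadratic_form_congruence:
  fixes A X :: "complex mat"
  assumes "A \<in> carrier_mat n n" "X \<in> carrier_mat n m" "y \<in> carrier_vec m"
  shows "conjugate (X *\<^sub>v y) \<bullet> (A *\<^sub>v (X *\<^sub>v y)) = conjugate y \<bullet> ((mat_adjoint X * A * X) *\<^sub>v y)"
proof -
  have "(mat_adjoint X * A * X) *\<^sub>v y = mat_adjoint X *\<^sub>v (A *\<^sub>v (X *\<^sub>v y))"
    using assms by (simp add: assoc_mult_mat_vec[of _ m n _ m] assoc_mult_mat_vec[of _ n n _ m])
  moreover have "conjugate y \<bullet> (mat_adjoint X *\<^sub>v (A *\<^sub>v (X *\<^sub>v y))) = conjugate (X *\<^sub>v y) \<bullet> (A *\<^sub>v (X *\<^sub>v y))"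
    using assms by (subst conjugate_scalar_prod_mult_mat[of _ m n]) auto
  ultimately show ?thesis by simp
qed

lemma hermitian_mat_congruence:
  assumes "A \<in> carrier_mat n n" "X \<in> carrier_mat n m" "hermitian_mat A"
  shows "hermitian_mat (mat_adjoint X * A * X)"
proof -
  have "mat_adjoint (mat_adjoint X * A * X) = mat_adjoint X * (mat_adjoint A * X)"
    using assms by (simp add: mat_adjoint_mult[of _ m n _ m] mat_adjoint_mult[of _ m n _ n] del: assoc_mult_mat)
  with assms show ?thesis
    by (simp add: hermitian_mat_def assoc_mult_mat[of _ m n _ n _ m] del: mat_adjoint_mat_adjoint)
qed

text \<open>\<open>X\<close> may be rectangular: with the adjoint of \<open>Km i\<close> for
  \<open>X\<close> the source covariance becomes a positive semidefinite matrix of size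
  \<open>J i\<close>.\<close>

lemma psd_mat_congruence:
  assumes "A \<in> carrier_mat n n" "X \<in> carrier_mat n m" "psd_mat A"
  shows "psd_mat (mat_adjoint X * A * X)"
  using assms hermitian_mat_congruence[of A n X m] quadratic_form_congruence[of A n X m, symmetric]
  by (auto simp: psd_mat_def)

lemma pd_mat_imp_psd_mat:
  assumes "pd_mat A"
  shows "psd_mat A"
proof -
  have "0 \<le> Re (conjugate v \<bullet> (A *\<^sub>v v))" if "v \<in> carrier_vec (dim_row A)" for v
    using assms that
    by (cases "v = 0\<^sub>v (dim_row A)") (auto simp: pd_mat_def scalar_prod_def intro: less_imp_le)
  with assms show ?thesis by (simp add: pd_mat_def psd_mat_def)
qed

lemma psd_mat_add:
  assumes "A \<in> carrier_mat n n" "B \<in> carrier_mat n n" "psd_mat A" "psd_mat B"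
  shows "psd_mat (A + B)"
proof -
  have "conjugate v \<bullet> ((A + B) *\<^sub>v v) = conjugate v \<bullet> (A *\<^sub>v v) + conjugate v \<bullet> (B *\<^sub>v v)"
    if "v \<in> carrier_vec n" for v
    using assms that by (simp add: add_mult_distrib_mat_vec[of _ n n] scalar_prod_add_distrib[of _ n])
  then show ?thesis
    using assms by (auto simp: psd_mat_def hermitian_mat_def mat_adjoint_add[of _ n n])
qed

lemma pd_mat_add_psd_mat:
  assumes "A \<in> carrier_mat n n" "B \<in> carrier_mat n n" "pd_mat A" "psd_mat B"
  shows "pd_mat (A + B)"
proof -
  have "conjugate v \<bullet> ((A + B) *\<^sub>v v) = conjugate v \<bullet> (A *\<^sub>v v) + conjugate v \<bullet> (B *\<^sub>v v)"
    if "v \<in> carrier_vec n" for v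
    using assms that by (simp add: add_mult_distrib_mat_vec[of _ n n] scalar_prod_add_distrib[of _ n])
  then show ?thesis
    using assms by (force simp: psd_mat_def pd_mat_def hermitian_mat_def mat_adjoint_add[of _ n n])
qed

text \<open>Exchanging the summations moves the conjugation to the other argument. The first
  Kronecker factors in \<open>matA\<close> and \<open>matE\<close> carry a transpose; as conjugation
  permutes the nonzero vectors, definiteness survives it.\<close>

lemma quadratic_form_transpose:
  fixes A :: "complex mat"
  assumes "A \<in> carrier_mat n n" "v \<in> carrier_vec n"
  shows "conjugate v \<bullet> (transpose_mat A *\<^sub>v v) = conjugate (conjugate v) \<bullet> (A *\<^sub>v conjugate v)"
proof -
  have "conjugate v \<bullet> (transpose_mat A *\<^sub>v v) = (\<Sum>a<n. \<Sum>b<n. cnj (v $ a) * A $$ (b, a) * v $ b)"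
    using assms by (subst quadratic_form_eq_sum[of _ n]) (auto intro!: sum.cong)
  also have "\<dots> = (\<Sum>b<n. \<Sum>a<n. cnj (v $ a) * A $$ (b, a) * v $ b)"
    by (rule sum.swap)
  also have "\<dots> = conjugate (conjugate v) \<bullet> (A *\<^sub>v conjugate v)"
    using assms by (subst quadratic_form_eq_sum[of _ n]) (auto intro!: sum.cong)
  finally show ?thesis .
qed

lemma hermitian_mat_dim: "hermitian_mat A \<Longrightarrow> A \<in> carrier_mat (dim_row A) (dim_row A)"
  by (metis carrier_matI hermitian_mat_def dim_mat_adjoint(1))

lemma hermitian_mat_index:
  assumes "hermitian_mat A" "i < dim_row A" "j < dim_row A"
  shows "cnj (A $$ (i, j)) = A $$ (j, i)"
proof -
  have "A $$ (j, i) = mat_adjoint A $$ (j, i)"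
    using assms by (simp add: hermitian_mat_def)
  also have "\<dots> = cnj (A $$ (i, j))"
    using assms carrier_matD(2)[OF hermitian_mat_dim[of A]] by simp
  finally show ?thesis ..
qed

lemma hermitian_mat_transpose: "hermitian_mat A \<Longrightarrow> hermitian_mat (transpose_mat A)"
  using carrier_matD(2)[OF hermitian_mat_dim[of A]] hermitian_mat_index[of A]
  unfolding hermitian_mat_def[of "transpose_mat A"] by (intro eq_matI) simp_all

lemma psd_mat_transpose:
  assumes "psd_mat A"
  shows "psd_mat (transpose_mat A)"
proof -
  have h: "hermitian_mat A" and c: "dim_col A = dim_row A"
    using assms carrier_matD(2)[OF hermitian_mat_dim] by (auto simp: psd_mat_def)
  have "conjugate v \<bullet> (transpose_mat A *\<^sub>v v) = conjugate (conjugate v) \<bullet> (A *\<^sub>v conjugate v)"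
    if "v \<in> carrier_vec (dim_row A)" for v
    using that by (rule quadratic_form_transpose[OF hermitian_mat_dim[OF h]])
  moreover have "0 \<le> Re (conjugate (conjugate v) \<bullet> (A *\<^sub>v conjugate v))" if "v \<in> carrier_vec (dim_row A)" for v
    using assms that unfolding psd_mat_def by (meson carrier_vec_conjugate)
  ultimately show ?thesis
    using c hermitian_mat_transpose[OF h] unfolding psd_mat_def by simp
qed

lemma pd_mat_transpose:
  assumes "pd_mat A"
  shows "pd_mat (transpose_mat A)"
proof -
  have h: "hermitian_mat A" and c: "dim_col A = dim_row A"
    using assms carrier_matD(2)[OF hermitian_mat_dim] by (auto simp: pd_mat_def)
  have "conjugate v \<bullet> (transpose_mat A *\<^sub>v v) = conjugate (conjugate v) \<bullet> (A *\<^sub>v conjugate v)"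
    if "v \<in> carrier_vec (dim_row A)" for v
    using that by (rule quadratic_form_transpose[OF hermitian_mat_dim[OF h]])
  moreover have "0 < Re (conjugate (conjugate v) \<bullet> (A *\<^sub>v conjugate v))"
    if "v \<in> carrier_vec (dim_row A)" "v \<noteq> 0\<^sub>v (dim_row A)" for v
    using assms that unfolding pd_mat_def
    by (metis carrier_vec_conjugate conjugate_id conjugate_zero_vec)
  ultimately show ?thesis
    using c hermitian_mat_transpose[OF h] unfolding pd_mat_def by simp
qed

text \<open>Brings the conjugated covariance in \<open>matC\<close> into the transposed form that
  \<open>matA\<close> and \<open>matE\<close> already have.\<close>

lemma hermitian_mat_cnj:
  assumes "hermitian_mat A"
  shows "map_mat cnj A = transpose_mat A"
proof (rule eq_matI)
  fix i j assume ij: "i < dim_row (transpose_mat A)" "j < dim_col (transpose_mat A)"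
  then have "i < dim_row A" "j < dim_row A" "j < dim_col A" "i < dim_col A"
    using carrier_matD(2)[OF hermitian_mat_dim[OF assms]] by simp_all
  then show "map_mat cnj A $$ (i, j) = transpose_mat A $$ (i, j)"
    using hermitian_mat_index[OF assms, of i j] by simp
qed (use carrier_matD(2)[OF hermitian_mat_dim[OF assms]] in simp_all)

section \<open>Kronecker products whose second factor is a Gram matrix\<close>

lemma dim_kronecker [simp]:
  "dim_row (kronecker A B) = dim_row A * dim_row B"
  "dim_col (kronecker A B) = dim_col A * dim_col B"
  by (simp_all add: kronecker_def)

lemma kronecker_carrier [simp]:
  "A \<in> carrier_mat a b \<Longrightarrow> B \<in> carrier_mat c d \<Longrightarrow> kronecker A B \<in> carrier_mat (a * c) (b * d)"
  by (intro carrier_matI) auto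

lemma mult_add_less:
  fixes i a k c :: nat
  assumes "i < a" "k < c"
  shows "i * c + k < a * c"
proof -
  have "i * c + k < Suc i * c" using assms by simp
  also have "\<dots> \<le> a * c" using assms by (intro mult_le_mono1) simp
  finally show ?thesis .
qed

text \<open>Row \<open>i * c + k\<close> is row \<open>k\<close> of block row \<open>i\<close>; this
  replaces the \<open>div\<close> and \<open>mod\<close> of the definition by independent
  indices.\<close>

lemma index_kronecker:
  assumes "A \<in> carrier_mat a b" "B \<in> carrier_mat c d" "i < a" "j < b" "k < c" "l < d"
  shows "kronecker A B $$ (i * c + k, j * d + l) = A $$ (i, j) * B $$ (k, l)"
proof -
  have "i * c + k < a * c" "j * d + l < b * d"
    using assms by (simp_all add: mult_add_less)
  then show ?thesis
    using assms by (simp add: kronecker_def)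
qed

lemma mat_adjoint_kronecker:
  "mat_adjoint (kronecker A B) = kronecker (mat_adjoint A) (mat_adjoint B)"
proof (rule eq_matI)
  fix i j assume "i < dim_row (kronecker (mat_adjoint A) (mat_adjoint B))"
    "j < dim_col (kronecker (mat_adjoint A) (mat_adjoint B))"
  then have ij: "i < dim_col A * dim_col B" "j < dim_row A * dim_row B"
    by auto
  then have "dim_col B > 0" "dim_row B > 0"
    by (auto intro!: Nat.gr0I)
  with ij show "mat_adjoint (kronecker A B) $$ (i, j) = kronecker (mat_adjoint A) (mat_adjoint B) $$ (i, j)"
    by (simp add: kronecker_def less_mult_imp_div_less)
qed auto

lemma sum_mult_lessThan:
  fixes h :: "nat \<Rightarrow> 'a::comm_monoid_add"
  shows "(\<Sum>k<a * c. h k) = (\<Sum>i<a. \<Sum>j<c. h (i * c + j))"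
proof (induction a)
  case (Suc a)
  have "(\<Sum>k<Suc a * c. h k) = (\<Sum>k<a * c. h k) + (\<Sum>k=a*c..<a*c+c. h k)"
    using sum.atLeastLessThan_concat[of 0 "a * c" "a * c + c" h] by (simp add: lessThan_atLeast0 add.commute)
  also have "(\<Sum>k=a*c..<a*c+c. h k) = (\<Sum>j<c. h (a * c + j))"
    using sum.shift_bounds_nat_ivl[of h 0 "a*c" c] by (simp add: lessThan_atLeast0 add.commute)
  finally show ?case using Suc by simp
qed simp

text \<open>With \<open>v\<close> read as a matrix with rows \<open>v\<^sub>a\<close>, the summand is the form of \<open>T\<close> at the vector of
  the \<open>k\<close>-th entries of \<open>Y v\<^sub>a\<close>.\<close>

lemma quadratic_form_kronecker_gram:
  fixes T Y :: "complex mat"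
  assumes T: "T \<in> carrier_mat m m" and Y: "Y \<in> carrier_mat c d" and v: "v \<in> carrier_vec (m * d)"
  shows "conjugate v \<bullet> (kronecker T (mat_adjoint Y * Y) *\<^sub>v v) =
    (\<Sum>k<c. conjugate (vec m (\<lambda>a. \<Sum>b<d. Y $$ (k, b) * v $ (a * d + b))) \<bullet>
      (T *\<^sub>v vec m (\<lambda>a. \<Sum>b<d. Y $$ (k, b) * v $ (a * d + b))))" (is "_ = (\<Sum>k<c. conjugate (?w k) \<bullet> _)")
proof -
  have ent: "kronecker T (mat_adjoint Y * Y) $$ (a * d + b, a' * d + b') =
      (\<Sum>k<c. T $$ (a, a') * cnj (Y $$ (k, b)) * Y $$ (k, b'))"
    if "a < m" "b < d" "a' < m" "b' < d" for a b a' b'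
    using that T Y
    by (subst index_kronecker[of _ m m _ d d])
      (auto simp: scalar_prod_def atLeast0LessThan sum_distrib_left mult.assoc intro!: sum.cong)
  have "conjugate v \<bullet> (kronecker T (mat_adjoint Y * Y) *\<^sub>v v) =
     (\<Sum>i<m*d. \<Sum>j<m*d. cnj (v $ i) * kronecker T (mat_adjoint Y * Y) $$ (i, j) * v $ j)"
    using assms by (intro quadratic_form_eq_sum kronecker_carrier) auto
  also have "\<dots> = (\<Sum>a<m. \<Sum>b<d. \<Sum>a'<m. \<Sum>b'<d. cnj (v $ (a*d+b)) *
       (\<Sum>k<c. T $$ (a, a') * cnj (Y $$ (k, b)) * Y $$ (k, b')) * v $ (a'*d+b'))"
    unfolding sum_mult_lessThan using ent by (intro sum.cong refl) auto
  also have "\<dots> = (\<Sum>a<m. \<Sum>b<d. \<Sum>a'<m. \<Sum>b'<d. \<Sum>k<c. cnj (v $ (a*d+b)) *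
       (T $$ (a, a') * cnj (Y $$ (k, b)) * Y $$ (k, b')) * v $ (a'*d+b'))"
    by (simp add: sum_distrib_left sum_distrib_right)
  also have "\<dots> = (\<Sum>k<c. \<Sum>a<m. \<Sum>b<d. \<Sum>a'<m. \<Sum>b'<d. cnj (v $ (a*d+b)) *
       (T $$ (a, a') * cnj (Y $$ (k, b)) * Y $$ (k, b')) * v $ (a'*d+b'))"
    by (rule sym, rule trans[OF sum.swap], rule sum.cong[OF refl], rule trans[OF sum.swap],
        rule sum.cong[OF refl], rule trans[OF sum.swap], rule sum.cong[OF refl], rule sum.swap)
  also have "\<dots> = (\<Sum>k<c. conjugate (?w k) \<bullet> (T *\<^sub>v ?w k))"
  proof (intro sum.cong refl)
    fix k
    have "conjugate (?w k) \<bullet> (T *\<^sub>v ?w k) = (\<Sum>a<m. \<Sum>a'<m. \<Sum>b<d. \<Sum>b'<d.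
       cnj (v $ (a*d+b)) * (T $$ (a, a') * cnj (Y $$ (k, b)) * Y $$ (k, b')) * v $ (a'*d+b'))"
      using T by (subst quadratic_form_eq_sum[of _ m])
        (simp_all add: sum_distrib_left sum_distrib_right mult_ac)
    also have "\<dots> = (\<Sum>a<m. \<Sum>b<d. \<Sum>a'<m. \<Sum>b'<d.
       cnj (v $ (a*d+b)) * (T $$ (a, a') * cnj (Y $$ (k, b)) * Y $$ (k, b')) * v $ (a'*d+b'))"
      by (rule sum.cong[OF refl], rule sum.swap)
    finally show "(\<Sum>a<m. \<Sum>b<d. \<Sum>a'<m. \<Sum>b'<d. cnj (v $ (a*d+b)) *
       (T $$ (a, a') * cnj (Y $$ (k, b)) * Y $$ (k, b')) * v $ (a'*d+b'))
       = conjugate (?w k) \<bullet> (T *\<^sub>v ?w k)" ..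
  qed
  finally show ?thesis .
qed

lemma hermitian_mat_kronecker_gram:
  assumes "hermitian_mat T"
  shows "hermitian_mat (kronecker T (mat_adjoint Y * Y))"
  using assms by (simp add: hermitian_mat_def mat_adjoint_kronecker mat_adjoint_mult[of _ "dim_col Y" "dim_row Y" _ "dim_col Y"])

text \<open>The form is a sum of values of the form of \<open>T\<close>. Having the second factor as
  a Gram matrix supplies this decomposition without factoring \<open>T\<close>.\<close>

lemma psd_mat_kronecker_gram:
  assumes T: "T \<in> carrier_mat m m" and Y: "Y \<in> carrier_mat c d" and psd: "psd_mat T"
  shows "psd_mat (kronecker T (mat_adjoint Y * Y))"
proof -
  have "hermitian_mat T" "\<And>w. w \<in> carrier_vec m \<Longrightarrow> 0 \<le> Re (conjugate w \<bullet> (T *\<^sub>v w))"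
    using psd T by (auto simp: psd_mat_def)
  then show ?thesis
    using T Y unfolding psd_mat_def
    by (auto simp: quadratic_form_kronecker_gram[OF T Y] hermitian_mat_kronecker_gram intro!: sum_nonneg)
qed

text \<open>The rows of the identity turn the vectors of the Gram decomposition into slices of
  \<open>v\<close>. A nonzero \<open>v\<close> has a nonzero slice, and one positive summand is
  enough.\<close>

lemma pd_mat_kronecker_one:
  assumes T: "T \<in> carrier_mat m m" and pd: "pd_mat T"
  shows "pd_mat (kronecker T (1\<^sub>m d))"
proof -
  let ?I = "1\<^sub>m d :: complex mat"
  have I: "?I = mat_adjoint ?I * ?I" by simp
  have psd: "psd_mat T" and T0: "\<And>w. w \<in> carrier_vec m \<Longrightarrow> w \<noteq> 0\<^sub>v m \<Longrightarrow> 0 < Re (conjugate w \<bullet> (T *\<^sub>v w))"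
    and T1: "\<And>w. w \<in> carrier_vec m \<Longrightarrow> 0 \<le> Re (conjugate w \<bullet> (T *\<^sub>v w))"
    using pd T pd_mat_imp_psd_mat[OF pd] by (auto simp: pd_mat_def psd_mat_def)
  have "0 < Re (conjugate v \<bullet> (kronecker T ?I *\<^sub>v v))" if v: "v \<in> carrier_vec (m * d)" and v0: "v \<noteq> 0\<^sub>v (m * d)" for v
  proof -
    obtain k where k: "k < m * d" "v $ k \<noteq> 0"
      using v v0 by (metis carrier_vecD eq_vecI index_zero_vec)
    \<comment> \<open>\<open>a * d + b\<close> locates the nonzero entry, so the slice of index
      \<open>b\<close> is nonzero at \<open>a\<close>.\<close>
    define a b where "a = k div d" and "b = k mod d"
    have d: "d > 0" using k by (auto intro!: Nat.gr0I)
    have ab: "a < m" "b < d" "a * d + b = k"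
      using k d by (auto simp: a_def b_def less_mult_imp_div_less)
    define w where "w k = vec m (\<lambda>a. \<Sum>b<d. ?I $$ (k, b) * v $ (a * d + b))" for k
    have w: "w k \<in> carrier_vec m" for k by (simp add: w_def)
    have "w b $ a = v $ k"
      using ab by (simp add: w_def if_distrib[of "\<lambda>x. x * _"] cong: if_cong)
    then have "w b \<noteq> 0\<^sub>v m" using k ab by auto
    then have "0 < (\<Sum>k<d. Re (conjugate (w k) \<bullet> (T *\<^sub>v w k)))"
      using ab T0[OF w] T1[OF w] by (intro sum_pos2[of _ b]) auto
    then show ?thesis
      using quadratic_form_kronecker_gram[of T m ?I d d v] T v by (simp add: w_def)
  qed
  then show ?thesis
    using T pd hermitian_mat_kronecker_gram[of T ?I] by (simp add: pd_mat_def)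
qed

section \<open>Spectral theorem, square root and pseudoinverse\<close>

text \<open>\<open>mat_inverse\<close> fails only on matrices that are not units of the matrix ring.
  A right inverse of a square matrix is two-sided, so it certifies a unit and coincides with the
  computed inverse.\<close>

lemma mat_inv_eqI:
  fixes A B :: "complex mat"
  assumes "A \<in> carrier_mat n n" "B \<in> carrier_mat n n" "A * B = 1\<^sub>m n"
  shows "mat_inv A = B" "invertible_mat A"
proof -
  have BA: "B * A = 1\<^sub>m n"
    using assms by (rule mat_mult_left_right_inverse)
  have "A \<in> Units (ring_mat TYPE(complex) n ())"
    using assms BA by (auto simp: Units_def ring_mat_def)
  then obtain C where C: "mat_inverse A = Some C"
    using mat_inverse(1)[OF assms(1), of "()"] by (cases "mat_inverse A") auto
  then have "A * C = 1\<^sub>m n" "C \<in> carrier_mat n n"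
    using mat_inverse(2)[OF assms(1)] by auto
  then have "C = B * A * C" using BA by simp
  also have "\<dots> = B * (A * C)"
    using assms \<open>C \<in> _\<close> by (intro assoc_mult_mat) auto
  also have "\<dots> = B"
    using assms \<open>A * C = _\<close> by simp
  finally show "mat_inv A = B"
    using C by (simp add: mat_inv_def)
  show "invertible_mat A"
    using assms BA by (auto simp: invertible_mat_def inverts_mat_def square_mat.simps intro!: exI[of _ B])
qed

text \<open>Complete \<open>v\<close> to a basis and apply Gram-Schmidt, which leaves the first
  vector as it is. The result is orthogonal but not normalized; dividing by the norms gives a
  unitary matrix whose first column is still a multiple of \<open>v\<close>.\<close>

lemma unitary_with_first_column:
  fixes v :: "complex vec"
  assumes v: "v \<in> carrier_vec n" and v0: "v \<noteq> 0\<^sub>v n"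
  obtains W c where "W \<in> carrier_mat n n" "mat_adjoint W * W = 1\<^sub>m n" "col W 0 = c \<cdot>\<^sub>v v"
proof -
  interpret cof_vec_space n "TYPE(complex)" .
  note b = basis_completion[OF v v0]
  define us where "us = gram_schmidt n (basis_completion v)"
  have us: "corthogonal us" "set us \<subseteq> carrier_vec n" "length us = n"
    using gram_schmidt_result[OF b(2) b(4) b(5) us_def] b(6) by auto
  have n: "n > 0" using v v0 by (intro Nat.gr0I) auto
  have "basis_completion v \<noteq> []" using b(6) n by auto
  then obtain w where w: "basis_completion v = v # w"
    using b(7) by (cases "basis_completion v") auto
  have us0: "us ! 0 = v"
  proof -
    have "hd us = v" using v by (simp add: us_def w)
    then show ?thesis using us(3) n by (cases us) auto
  qed
  have uc: "us ! j \<in> carrier_vec n" if "j < n" for j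
    using us that by auto
  then have ud: "dim_vec (us ! j) = n" if "j < n" for j
    using that by auto
  define c where "c j = complex_of_real (1 / sqrt (Re (us ! j \<bullet>c us ! j)))" for j
  define W where "W = mat n n (\<lambda>(i, j). c j * us ! j $ i)"
  have W: "W \<in> carrier_mat n n" by (simp add: W_def)
  have nrm: "us ! j \<bullet>c us ! j = complex_of_real (\<Sum>k<n. (cmod (us ! j $ k))\<^sup>2)" if "j < n" for j
    using uc[OF that] by (simp add: scalar_prod_def atLeast0LessThan complex_norm_square del: of_real_power)
  have "(mat_adjoint W * W) $$ (i, j) = (if i = j then 1 else 0)" if ij: "i < n" "j < n" for i j
  proof -
    have "(mat_adjoint W * W) $$ (i, j) = cnj (c i) * c j * (us ! j \<bullet>c us ! i)"
      using ij ud W by (auto simp: W_def scalar_prod_def sum_distrib_left mult_ac intro!: sum.cong)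
    also have "\<dots> = (if i = j then 1 else 0)"
    proof (cases "i = j")
      case True
      have ne: "us ! j \<bullet>c us ! j \<noteq> 0"
        using corthogonalD[OF us(1), of j j] ij us(3) by simp
      define s where "s = (\<Sum>k<n. (cmod (us ! j $ k))\<^sup>2)"
      have s1: "us ! j \<bullet>c us ! j = complex_of_real s"
        using nrm[OF ij(2)] by (simp only: s_def)
      have "s \<ge> 0" unfolding s_def by (intro sum_nonneg) simp
      with ne s1 have s: "us ! j \<bullet>c us ! j = complex_of_real s" "s > 0"
        by (auto simp: less_le)
      then have "cnj (c i) * c j * (us ! j \<bullet>c us ! i) = complex_of_real (1 / sqrt s * (1 / sqrt s) * s)"
        using True unfolding c_def by (simp del: of_real_divide of_real_mult add: of_real_mult[symmetric] mult.assoc[symmetric])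
      also have "1 / sqrt s * (1 / sqrt s) * s = 1"
        using s(2) by simp
      finally show ?thesis using True by simp
    next
      case False
      then show ?thesis
        using corthogonalD[OF us(1), of j i] ij us(3) by simp
    qed
    finally show ?thesis .
  qed
  then have "mat_adjoint W * W = 1\<^sub>m n"
    using W by (intro eq_matI) auto
  moreover have "col W 0 = c 0 \<cdot>\<^sub>v v"
    using n us0 v by (intro eq_vecI) (auto simp: W_def)
  ultimately show ?thesis using W that by blast
qed

lemma mat_adjoint_four_block_diag:
  fixes A D :: "complex mat"
  assumes "A \<in> carrier_mat k k" "D \<in> carrier_mat m m"
  shows "mat_adjoint (four_block_mat A (0\<^sub>m k m) (0\<^sub>m m k) D) =
    four_block_mat (mat_adjoint A) (0\<^sub>m k m) (0\<^sub>m m k) (mat_adjoint D)"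
  using assms by (intro eq_matI) (auto simp: not_less)

lemma mult_four_block_diag:
  fixes A D A' D' :: "complex mat"
  assumes "A \<in> carrier_mat k k" "D \<in> carrier_mat m m" "A' \<in> carrier_mat k k" "D' \<in> carrier_mat m m"
  shows "four_block_mat A (0\<^sub>m k m) (0\<^sub>m m k) D * four_block_mat A' (0\<^sub>m k m) (0\<^sub>m m k) D' =
    four_block_mat (A * A') (0\<^sub>m k m) (0\<^sub>m m k) (D * D')"
  using assms by (subst mult_four_block_mat[of _ k k _ m _ m _ _ k _ m]) auto

text \<open>Induction by deflation: a unitary with an eigenvector as first column clears the first
  column below the diagonal, Hermitian symmetry clears the first row, and the remaining block is
  Hermitian of smaller size.\<close>

lemma hermitian_mat_diagonalizable:
  assumes "A \<in> carrier_mat n n" "hermitian_mat A"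
  shows "\<exists>U D. U \<in> carrier_mat n n \<and> D \<in> carrier_mat n n \<and> diagonal_mat D \<and>
    mat_adjoint U * U = 1\<^sub>m n \<and> A = U * D * mat_adjoint U"
  using assms
proof (induction n arbitrary: A)
  case 0
  then show ?case
    by (intro exI[of _ "1\<^sub>m 0"] exI[of _ A]) (auto simp: diagonal_mat_def)
next
  case (Suc n)
  note A = Suc.prems(1)
  \<comment> \<open>Algebraic closedness of the complex numbers enters here.\<close>
  obtain e where "eigenvalue A e"
    using spectrum_non_empty[OF A] by (auto simp: spectrum_def)
  then obtain v where v: "v \<in> carrier_vec (Suc n)" "v \<noteq> 0\<^sub>v (Suc n)" "A *\<^sub>v v = e \<cdot>\<^sub>v v"
    using A by (auto simp: eigenvalue_def eigenvector_def)
  obtain W c where W: "W \<in> carrier_mat (Suc n) (Suc n)" "mat_adjoint W * W = 1\<^sub>m (Suc n)" "col W 0 = c \<cdot>\<^sub>v v"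
    using unitary_with_first_column[OF v(1,2)] by blast
  have W': "W * mat_adjoint W = 1\<^sub>m (Suc n)"
    using W by (intro mat_mult_left_right_inverse[of "mat_adjoint W" "Suc n" W]) auto
  define A' where "A' = mat_adjoint W * A * W"
  have A': "A' \<in> carrier_mat (Suc n) (Suc n)" using A W by (simp add: A'_def)
  have A'h: "hermitian_mat A'"
    unfolding A'_def by (rule hermitian_mat_congruence[OF A W(1) Suc.prems(2)])
  have AA': "A = W * A' * mat_adjoint W"
  proof -
    have "W * A' * mat_adjoint W = (W * mat_adjoint W) * A * (W * mat_adjoint W)"
      using A W(1) unfolding A'_def
      by (simp add: assoc_mult_mat[of _ "Suc n" "Suc n" _ "Suc n" _ "Suc n"])
    then show ?thesis using A W' by simp
  qed
  \<comment> \<open>The first column w of \<open>W\<close> is an eigenvector and W^H w is the first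
    unit vector, so W^H A w is \<open>e\<close> times that unit vector.\<close>
  have col0: "A' $$ (i, 0) = (if i = 0 then e else 0)" if "i < Suc n" for i
  proof -
    have cW: "col W 0 \<in> carrier_vec (Suc n)"
      unfolding W(3) using v by simp
    have "col A' 0 = (mat_adjoint W * A) *\<^sub>v col W 0"
      unfolding A'_def by (rule col_mult2) (use A W(1) in auto)
    also have "\<dots> = mat_adjoint W *\<^sub>v (A *\<^sub>v col W 0)"
      by (rule assoc_mult_mat_vec) (use A W(1) cW in auto)
    also have "A *\<^sub>v col W 0 = e \<cdot>\<^sub>v col W 0"
      unfolding W(3) using A v by (simp add: mult_mat_vec[of _ "Suc n" "Suc n"] smult_smult_assoc mult.commute)
    also have "mat_adjoint W *\<^sub>v \<dots> = e \<cdot>\<^sub>v col (mat_adjoint W * W) 0"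
      using W(1) cW by (subst col_mult2[of _ "Suc n" "Suc n" _ "Suc n"]) (auto intro!: mult_mat_vec[of _ "Suc n" "Suc n"])
    also have "\<dots> = e \<cdot>\<^sub>v unit_vec (Suc n) 0"
      unfolding W(2) by simp
    finally have "col A' 0 $ i = (e \<cdot>\<^sub>v unit_vec (Suc n) 0) $ i"
      by simp
    then show ?thesis using that A' by (auto simp: unit_vec_def)
  qed
  have row0: "A' $$ (0, i) = 0" if "0 < i" "i < Suc n" for i
    using hermitian_mat_index[OF A'h, of i 0] col0[of i] that A' by simp
  define A2 where "A2 = mat n n (\<lambda>(i, j). A' $$ (Suc i, Suc j))"
  have A2: "A2 \<in> carrier_mat n n" by (simp add: A2_def)
  define e1 where "e1 = mat 1 1 (\<lambda>(i::nat, j::nat). e)"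
  have e1: "e1 \<in> carrier_mat 1 1" by (simp add: e1_def)
  have split: "A' = four_block_mat e1 (0\<^sub>m 1 n) (0\<^sub>m n 1) A2"
    using A' by (intro eq_matI) (auto simp: A2_def e1_def col0 row0 not_less le_Suc_eq)
  have "hermitian_mat A2"
    using hermitian_mat_index[OF A'h] A' unfolding hermitian_mat_def
    by (intro eq_matI) (auto simp: A2_def)
  then obtain U D where UD: "U \<in> carrier_mat n n" "D \<in> carrier_mat n n" "diagonal_mat D"
    "mat_adjoint U * U = 1\<^sub>m n" "A2 = U * D * mat_adjoint U"
    using Suc.IH[OF A2] by blast
  define V where "V = four_block_mat (1\<^sub>m 1) (0\<^sub>m 1 n) (0\<^sub>m n 1) U"
  define F where "F = four_block_mat e1 (0\<^sub>m 1 n) (0\<^sub>m n 1) D"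
  have V: "V \<in> carrier_mat (Suc n) (Suc n)" and F: "F \<in> carrier_mat (Suc n) (Suc n)"
    using UD e1 by (auto simp: V_def F_def)
  have VV: "mat_adjoint V * V = 1\<^sub>m (Suc n)"
    using UD by (simp add: V_def mat_adjoint_four_block_diag mult_four_block_diag four_block_one_mat)
  have A'V: "A' = V * F * mat_adjoint V"
    using UD e1 unfolding split by (simp add: V_def F_def mat_adjoint_four_block_diag mult_four_block_diag)
  have "diagonal_mat F"
    using UD e1 by (auto simp: diagonal_mat_def F_def)
  moreover have "mat_adjoint (W * V) * (W * V) = 1\<^sub>m (Suc n)"
  proof -
    have "mat_adjoint (W * V) * (W * V) = mat_adjoint V * (mat_adjoint W * W) * V"
      using W(1) V by (simp add: mat_adjoint_mult[of _ "Suc n" "Suc n" _ "Suc n"]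
          assoc_mult_mat[of _ "Suc n" "Suc n" _ "Suc n" _ "Suc n"])
    then show ?thesis using W(2) V VV by simp
  qed
  moreover have "A = (W * V) * F * mat_adjoint (W * V)"
    unfolding AA' A'V using W(1) V F
    by (simp add: mat_adjoint_mult[of _ "Suc n" "Suc n" _ "Suc n"]
          assoc_mult_mat[of _ "Suc n" "Suc n" _ "Suc n" _ "Suc n"])
  ultimately show ?case
    using W(1) V F by (intro exI[of _ "W * V"] exI[of _ F]) auto
qed

text \<open>The left inverse \<open>Y\<close> keeps \<open>X *\<^sub>v v\<close> nonzero for nonzero
  \<open>v\<close>, as strict positivity requires.\<close>

lemma pd_mat_congruence:
  assumes A: "A \<in> carrier_mat n n" "pd_mat A" and X: "X \<in> carrier_mat n n" "Y \<in> carrier_mat n n" "Y * X = 1\<^sub>m n"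
  shows "pd_mat (mat_adjoint X * A * X)"
proof -
  have "hermitian_mat (mat_adjoint X * A * X)"
    using A X by (intro hermitian_mat_congruence[of A n]) (auto simp: pd_mat_def)
  moreover have "0 < Re (conjugate v \<bullet> ((mat_adjoint X * A * X) *\<^sub>v v))"
    if v: "v \<in> carrier_vec n" "v \<noteq> 0\<^sub>v n" for v
  proof -
    have "X *\<^sub>v v \<noteq> 0\<^sub>v n"
    proof
      assume 0: "X *\<^sub>v v = 0\<^sub>v n"
      have "v = (Y * X) *\<^sub>v v" using X v by simp
      also have "\<dots> = Y *\<^sub>v (X *\<^sub>v v)"
        by (rule assoc_mult_mat_vec) (use X v in auto)
      also have "\<dots> = 0\<^sub>v n"
        unfolding 0 using X by (intro eq_vecI) auto
      finally show False using v by simp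
    qed
    moreover have "X *\<^sub>v v \<in> carrier_vec n"
      by (rule mult_mat_vec_carrier[OF X(1) v(1)])
    ultimately have "0 < Re (conjugate (X *\<^sub>v v) \<bullet> (A *\<^sub>v (X *\<^sub>v v)))"
      using A unfolding pd_mat_def by auto
    then show ?thesis
      unfolding quadratic_form_congruence[OF A(1) X(1) v(1)] .
  qed
  ultimately show ?thesis
    using A X by (simp add: pd_mat_def)
qed

lemma diagonal_mat_eq_mat_diag:
  "D \<in> carrier_mat n n \<Longrightarrow> diagonal_mat D \<Longrightarrow> D = mat_diag n (\<lambda>k. D $$ (k, k))"
  by (intro eq_matI) (auto simp: mat_diag_def diagonal_mat_def)

lemma mat_diag_mult_vec:
  fixes d :: "nat \<Rightarrow> complex"
  assumes "y \<in> carrier_vec n"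
  shows "mat_diag n d *\<^sub>v y = vec n (\<lambda>k. d k * y $ k)"
  using assms
  by (intro eq_vecI) (auto simp: mat_diag_def scalar_prod_def if_distrib[of "\<lambda>x. x * _"] sum.delta cong: if_cong)

lemma mat_adjoint_mat_diag: "mat_adjoint (mat_diag n d) = mat_diag n (\<lambda>k. cnj (d k))"
  by (rule eq_matI) (auto simp: mat_diag_def)

lemma quadratic_form_mat_diag:
  assumes "y \<in> carrier_vec n"
  shows "conjugate y \<bullet> (mat_diag n d *\<^sub>v y) = (\<Sum>k<n. d k * complex_of_real ((cmod (y $ k))\<^sup>2))"
  unfolding mat_diag_mult_vec[OF assms] using assms
  by (auto simp: scalar_prod_def atLeast0LessThan complex_norm_square mult_ac simp del: of_real_power intro!: sum.cong)

lemma Re_quadratic_form_mat_diag: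
  assumes "y \<in> carrier_vec n"
  shows "Re (conjugate y \<bullet> (mat_diag n (\<lambda>k. complex_of_real (d k)) *\<^sub>v y)) = (\<Sum>k<n. d k * (cmod (y $ k))\<^sup>2)"
  unfolding quadratic_form_mat_diag[OF assms] by (simp del: of_real_power)

lemma pd_mat_mat_diag:
  assumes "\<And>k. k < n \<Longrightarrow> d k > 0"
  shows "pd_mat (mat_diag n (\<lambda>k. complex_of_real (d k)))"
proof -
  have "0 < (\<Sum>k<n. d k * (cmod (y $ k))\<^sup>2)" if y: "y \<in> carrier_vec n" "y \<noteq> 0\<^sub>v n" for y
  proof -
    obtain k where k: "k < n" "y $ k \<noteq> 0"
      using y by (metis carrier_vecD eq_vecI index_zero_vec)
    then show ?thesis
      using assms by (intro sum_pos2[of _ k]) (auto simp: less_imp_le)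
  qed
  moreover have "dim_row (mat_diag n (\<lambda>k. complex_of_real (d k))) = n"
    by (simp add: mat_diag_def)
  ultimately show ?thesis
    by (simp add: pd_mat_def hermitian_mat_def mat_adjoint_mat_diag Re_quadratic_form_mat_diag)
qed

lemma unitary_conjugation_mult:
  fixes U X Y :: "complex mat"
  assumes "U \<in> carrier_mat n n" "mat_adjoint U * U = 1\<^sub>m n" "X \<in> carrier_mat n n" "Y \<in> carrier_mat n n"
  shows "(U * X * mat_adjoint U) * (U * Y * mat_adjoint U) = U * (X * Y) * mat_adjoint U"
proof -
  have "(U * X * mat_adjoint U) * (U * Y * mat_adjoint U) = U * X * (mat_adjoint U * U) * (Y * mat_adjoint U)"
    using assms(1,3,4) by (simp add: assoc_mult_mat[of _ n n _ n _ n])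
  also have "\<dots> = U * (X * Y) * mat_adjoint U"
    unfolding assms(2) using assms(1,3,4) by (simp add: assoc_mult_mat[of _ n n _ n _ n])
  finally show ?thesis .
qed

lemma unitary_conjugation_inverse:
  fixes U A D :: "complex mat"
  assumes "U \<in> carrier_mat n n" "mat_adjoint U * U = 1\<^sub>m n" "D \<in> carrier_mat n n" "A = U * D * mat_adjoint U"
  shows "mat_adjoint U * A * U = D"
proof -
  have "mat_adjoint U * A * U = (mat_adjoint U * U) * D * (mat_adjoint U * U)"
    unfolding assms(4) using assms(1,3) by (simp add: assoc_mult_mat[of _ n n _ n _ n])
  then show ?thesis using assms by simp
qed

section \<open>The positive definite square root and its inverse\<close>

lemma pd_mat_nonsingular:
  assumes A: "A \<in> carrier_mat n n" and "pd_mat A"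
  obtains B where "B \<in> carrier_mat n n" "A * B = 1\<^sub>m n" "B * A = 1\<^sub>m n"
proof -
  have "det A \<noteq> 0"
  proof
    assume "det A = 0"
    then obtain v where v: "v \<in> carrier_vec n" "v \<noteq> 0\<^sub>v n" "A *\<^sub>v v = 0\<^sub>v n"
      using det_0_iff_vec_prod_zero[OF A] by auto
    then have "conjugate v \<bullet> (A *\<^sub>v v) = 0" by simp
    then show False
      using assms v unfolding pd_mat_def by fastforce
  qed
  then have "A \<in> Units (ring_mat TYPE(complex) n ())"
    by (rule det_non_zero_imp_unit[OF A])
  then show ?thesis using that by (auto simp: Units_def ring_mat_def)
qed

text \<open>If \<open>R\<^sup>2 = T\<^sup>2\<close> then \<open>\<Delta> = R - T\<close> satisfies \<open>R \<Delta> + \<Delta> T = 0\<close>; applied to an eigenvector of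
  \<open>\<Delta>\<close> with eigenvalue \<open>\<delta>\<close>, the form of this identity is \<open>\<delta>\<close> times a positive number.\<close>

lemma pd_mat_square_inject:
  assumes R: "R \<in> carrier_mat n n" "pd_mat R" and T: "T \<in> carrier_mat n n" "pd_mat T"
    and sq: "R * R = T * T"
  shows "R = T"
proof -
  define \<Delta> where "\<Delta> = R - T"
  have \<Delta>: "\<Delta> \<in> carrier_mat n n" using R T by (simp add: \<Delta>_def minus_carrier_mat)
  have herm: "hermitian_mat \<Delta>"
    unfolding hermitian_mat_def
  proof (rule eq_matI)
    fix i j assume "i < dim_row \<Delta>" "j < dim_col \<Delta>"
    then show "mat_adjoint \<Delta> $$ (i, j) = \<Delta> $$ (i, j)"
      using R T hermitian_mat_index[of R j i] hermitian_mat_index[of T j i] by (simp add: \<Delta>_def pd_mat_def)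
  qed (use \<Delta> in auto)
  \<comment> \<open>The mixed products cancel: R (R - T) + (R - T) T = R R - T T.\<close>
  have zero: "R * \<Delta> + \<Delta> * T = 0\<^sub>m n n"
  proof -
    have "R * \<Delta> = R * R - R * T" "\<Delta> * T = R * T - T * T"
      unfolding \<Delta>_def using R T by (auto simp: mult_minus_distrib_mat minus_mult_distrib_mat)
    moreover have "R * T \<in> carrier_mat n n" "T * T \<in> carrier_mat n n" using R T by auto
    moreover have "(X - Y) + (Y - X) = 0\<^sub>m n n"
      if "X \<in> carrier_mat n n" "Y \<in> carrier_mat n n" for X Y :: "complex mat"
      using that by (intro eq_matI) auto
    ultimately show ?thesis unfolding sq by simp
  qed
  obtain V D where V: "V \<in> carrier_mat n n" "D \<in> carrier_mat n n" "diagonal_mat D"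
    "mat_adjoint V * V = 1\<^sub>m n" "\<Delta> = V * D * mat_adjoint V"
    using hermitian_mat_diagonalizable[OF \<Delta> herm] by blast
  have VV: "V * mat_adjoint V = 1\<^sub>m n"
    using V by (intro mat_mult_left_right_inverse[of "mat_adjoint V" n V]) auto
  have "mat_adjoint V * \<Delta> * V = D"
    by (rule unitary_conjugation_inverse[OF V(1,4,2,5)])
  then have "hermitian_mat D"
    using hermitian_mat_congruence[OF \<Delta> V(1) herm] by simp
  have "D $$ (k, k) = 0" if k: "k < n" for k
  proof -
    define \<delta> where "\<delta> = Re (D $$ (k, k))"
    have "cnj (D $$ (k, k)) = D $$ (k, k)"
      using hermitian_mat_index[OF \<open>hermitian_mat D\<close>, of k k] V k by simp
    then have \<delta>: "D $$ (k, k) = complex_of_real \<delta>"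
      by (simp add: \<delta>_def complex_eq_iff)
    \<comment> \<open>Column \<open>k\<close> of \<open>V\<close>, an eigenvector of \<Delta> for
      \<delta>.\<close>
    define v where "v = V *\<^sub>v unit_vec n k"
    have v: "v \<in> carrier_vec n" using V by (simp add: v_def)
    have Vv: "mat_adjoint V *\<^sub>v v = unit_vec n k"
    proof -
      have "mat_adjoint V *\<^sub>v v = (mat_adjoint V * V) *\<^sub>v unit_vec n k"
        unfolding v_def by (rule assoc_mult_mat_vec[symmetric]) (use V in auto)
      then show ?thesis using V(4) by simp
    qed
    have v0: "v \<noteq> 0\<^sub>v n"
    proof
      assume "v = 0\<^sub>v n"
      then have "mat_adjoint V *\<^sub>v v = 0\<^sub>v n" using V by (intro eq_vecI) auto
      then show False using Vv k by (metis index_unit_vec(1) index_zero_vec(1) zero_neq_one)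
    qed
    have \<Delta>v: "\<Delta> *\<^sub>v v = complex_of_real \<delta> \<cdot>\<^sub>v v"
    proof -
      have "\<Delta> *\<^sub>v v = (V * D) *\<^sub>v (mat_adjoint V *\<^sub>v v)"
        unfolding V(5) by (rule assoc_mult_mat_vec) (use V v in auto)
      also have "\<dots> = V *\<^sub>v (D *\<^sub>v unit_vec n k)"
        unfolding Vv by (rule assoc_mult_mat_vec) (use V in auto)
      also have "D *\<^sub>v unit_vec n k = complex_of_real \<delta> \<cdot>\<^sub>v unit_vec n k"
        using V(2,3) k \<delta>
        by (subst diagonal_mat_eq_mat_diag[OF V(2,3)], subst mat_diag_mult_vec) (auto intro!: eq_vecI)
      also have "V *\<^sub>v (complex_of_real \<delta> \<cdot>\<^sub>v unit_vec n k) = complex_of_real \<delta> \<cdot>\<^sub>v v"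
        unfolding v_def by (rule mult_mat_vec) (use V in auto)
      finally show ?thesis .
    qed
    have Tv: "T *\<^sub>v v \<in> carrier_vec n" and Rv: "R *\<^sub>v v \<in> carrier_vec n"
      and R\<Delta>v: "R *\<^sub>v (\<Delta> *\<^sub>v v) \<in> carrier_vec n" and \<Delta>Tv: "\<Delta> *\<^sub>v (T *\<^sub>v v) \<in> carrier_vec n"
      using R(1) T(1) \<Delta> v by (meson mult_mat_vec_carrier)+
    have "0\<^sub>m n n *\<^sub>v v = 0\<^sub>v n"
      using v by (intro eq_vecI) auto
    then have "0 = conjugate v \<bullet> ((R * \<Delta> + \<Delta> * T) *\<^sub>v v)"
      unfolding zero using v by simp
    also have "(R * \<Delta> + \<Delta> * T) *\<^sub>v v = R *\<^sub>v (\<Delta> *\<^sub>v v) + \<Delta> *\<^sub>v (T *\<^sub>v v)"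
      using R T \<Delta> v by (subst add_mult_distrib_mat_vec[of _ n n])
        (auto intro!: arg_cong2[of _ _ _ _ "(+)"] assoc_mult_mat_vec)
    also have "conjugate v \<bullet> \<dots> = conjugate v \<bullet> (R *\<^sub>v (\<Delta> *\<^sub>v v)) + conjugate v \<bullet> (\<Delta> *\<^sub>v (T *\<^sub>v v))"
      by (rule scalar_prod_add_distrib[of _ n]) (use v R\<Delta>v \<Delta>Tv in simp_all)
    \<comment> \<open>\<Delta> is Hermitian, so it moves to the left argument, where it again acts
      as the real scalar \<delta>.\<close>
    also have "conjugate v \<bullet> (\<Delta> *\<^sub>v (T *\<^sub>v v)) = conjugate (\<Delta> *\<^sub>v v) \<bullet> (T *\<^sub>v v)"
      using conjugate_scalar_prod_mult_mat[OF \<Delta> v Tv] herm by (simp add: hermitian_mat_def)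
    also have "\<dots> = complex_of_real \<delta> * (conjugate v \<bullet> (T *\<^sub>v v))"
      unfolding \<Delta>v using v Tv by (simp add: conjugate_smult_vec smult_scalar_prod_distrib[of _ n])
    also have "conjugate v \<bullet> (R *\<^sub>v (\<Delta> *\<^sub>v v)) = complex_of_real \<delta> * (conjugate v \<bullet> (R *\<^sub>v v))"
      unfolding \<Delta>v mult_mat_vec[OF R(1) v] using v Rv by (simp add: scalar_prod_smult_distrib[of _ n])
    finally have "0 = Re (complex_of_real \<delta> * (conjugate v \<bullet> (R *\<^sub>v v)) + complex_of_real \<delta> * (conjugate v \<bullet> (T *\<^sub>v v)))"
      by (metis zero_complex.sel(1))
    then have "\<delta> * (Re (conjugate v \<bullet> (R *\<^sub>v v)) + Re (conjugate v \<bullet> (T *\<^sub>v v))) = 0"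
      by (simp add: algebra_simps)
    moreover have "Re (conjugate v \<bullet> (R *\<^sub>v v)) + Re (conjugate v \<bullet> (T *\<^sub>v v)) > 0"
      using R T v v0 by (intro add_pos_pos) (auto simp: pd_mat_def)
    ultimately show ?thesis using \<delta> by auto
  qed
  then have "D = 0\<^sub>m n n"
    using V(2,3) by (intro eq_matI) (auto simp: diagonal_mat_def)
  then have "\<Delta> = 0\<^sub>m n n"
    unfolding V(5) using V(1) by simp
  then have "R $$ (i, j) - T $$ (i, j) = 0" if "i < n" "j < n" for i j
    using R T that unfolding \<Delta>_def by (metis carrier_matD index_minus_mat(1) index_zero_mat(1))
  then show ?thesis using R T by (intro eq_matI) auto
qed

text \<open>Discharges the definite description: a root arises from the square roots of the
  eigenvalues, and uniqueness is \<open>pd_mat_square_inject\<close>.\<close>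

lemma pd_sqrt:
  assumes E: "E \<in> carrier_mat n n" "pd_mat E"
  shows "pd_sqrt E \<in> carrier_mat n n" "pd_mat (pd_sqrt E)" "pd_sqrt E * pd_sqrt E = E"
proof -
  obtain U D where U: "U \<in> carrier_mat n n" "D \<in> carrier_mat n n" "diagonal_mat D"
    "mat_adjoint U * U = 1\<^sub>m n" "E = U * D * mat_adjoint U"
    using hermitian_mat_diagonalizable[OF E(1)] E(2) by (auto simp: pd_mat_def)
  have UU: "U * mat_adjoint U = 1\<^sub>m n"
    using U by (intro mat_mult_left_right_inverse[of "mat_adjoint U" n U]) auto
  have "mat_adjoint U * E * U = D"
    by (rule unitary_conjugation_inverse[OF U(1,4,2,5)])
  then have pdD: "pd_mat D"
    using pd_mat_congruence[OF E U(1), of "mat_adjoint U"] U(1,4) by simp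
  define d where "d k = Re (D $$ (k, k))" for k
  have dD: "D $$ (k, k) = complex_of_real (d k)" if "k < n" for k
    using hermitian_mat_index[of D k k] pdD U that by (simp add: d_def complex_eq_iff pd_mat_def)
  have D: "D = mat_diag n (\<lambda>k. complex_of_real (d k))"
    using dD U(2,3) by (intro eq_matI) (auto simp: mat_diag_def diagonal_mat_def)
  have pos: "d k > 0" if "k < n" for k
  proof -
    have "0 < Re (conjugate (unit_vec n k) \<bullet> (D *\<^sub>v unit_vec n k))"
      using pdD U(2) that unfolding pd_mat_def
      by (metis carrier_matD(1) index_unit_vec(1) index_zero_vec(1) unit_vec_carrier zero_neq_one)
    also have "\<dots> = (\<Sum>j<n. d j * (cmod (unit_vec n k $ j))\<^sup>2)"
      unfolding D by (rule Re_quadratic_form_mat_diag) simp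
    also have "\<dots> = (\<Sum>j<n. if j = k then d k else 0)"
      by (intro sum.cong) (auto simp: unit_vec_def)
    also have "\<dots> = d k" using that by simp
    finally show ?thesis .
  qed
  define R where "R = U * mat_diag n (\<lambda>k. complex_of_real (sqrt (d k))) * mat_adjoint U"
  have "R \<in> carrier_mat n n" using U by (auto simp: R_def)
  moreover have "pd_mat R"
    unfolding R_def
    using pd_mat_congruence[of "mat_diag n (\<lambda>k. complex_of_real (sqrt (d k)))" n "mat_adjoint U" U]
      pd_mat_mat_diag[of n "\<lambda>k. sqrt (d k)"] U(1) UU pos by simp
  moreover have "R * R = E"
  proof -
    have "R * R = U * (mat_diag n (\<lambda>k. complex_of_real (sqrt (d k))) * mat_diag n (\<lambda>k. complex_of_real (sqrt (d k)))) * mat_adjoint U"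
      unfolding R_def by (rule unitary_conjugation_mult[OF U(1,4)]) auto
    also have "mat_diag n (\<lambda>k. complex_of_real (sqrt (d k))) * mat_diag n (\<lambda>k. complex_of_real (sqrt (d k))) = D"
      unfolding D mat_diag_diag
      using pos by (intro eq_matI) (auto simp: mat_diag_def of_real_mult[symmetric] less_imp_le simp del: of_real_mult)
    finally show ?thesis using U(5) by simp
  qed
  ultimately have "R \<in> carrier_mat (dim_row E) (dim_row E) \<and> pd_mat R \<and> R * R = E"
    using E by simp
  moreover have "T = R" if "T \<in> carrier_mat (dim_row E) (dim_row E) \<and> pd_mat T \<and> T * T = E" for T
    using that \<open>R \<in> carrier_mat n n\<close> \<open>pd_mat R\<close> \<open>R * R = E\<close> E by (intro pd_mat_square_inject[of T n R]) auto
  ultimately have "pd_sqrt E \<in> carrier_mat (dim_row E) (dim_row E) \<and> pd_mat (pd_sqrt E) \<and> pd_sqrt E * pd_sqrt E = E"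
    unfolding pd_sqrt_def by (rule theI)
  then show "pd_sqrt E \<in> carrier_mat n n" "pd_mat (pd_sqrt E)" "pd_sqrt E * pd_sqrt E = E"
    using E by auto
qed

text \<open>The inverse is Hermitian because its adjoint is again a right inverse of the Hermitian
  root. This symmetry makes \<open>S * Q * S\<close> a congruence.\<close>

lemma mat_inv_pd_sqrt:
  assumes E: "E \<in> carrier_mat n n" "pd_mat E"
  defines "S \<equiv> mat_inv (pd_sqrt E)"
  shows "S \<in> carrier_mat n n" "hermitian_mat S" "S * pd_sqrt E = 1\<^sub>m n" "pd_sqrt E * S = 1\<^sub>m n"
proof -
  note R = pd_sqrt[OF E]
  obtain B where B: "B \<in> carrier_mat n n" "pd_sqrt E * B = 1\<^sub>m n" "B * pd_sqrt E = 1\<^sub>m n"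
    using pd_mat_nonsingular[OF R(1,2)] by blast
  have S: "S = B"
    unfolding S_def by (rule mat_inv_eqI[OF R(1) B(1,2)])
  show "S \<in> carrier_mat n n" "S * pd_sqrt E = 1\<^sub>m n" "pd_sqrt E * S = 1\<^sub>m n"
    using B S by auto
  have Rh: "mat_adjoint (pd_sqrt E) = pd_sqrt E" using R(2) by (simp add: pd_mat_def hermitian_mat_def)
  have "pd_sqrt E * mat_adjoint B = 1\<^sub>m n"
    using mat_adjoint_mult[OF B(1) R(1)] B(3) Rh by simp
  then have "mat_inv (pd_sqrt E) = mat_adjoint B"
    using B(1) by (intro mat_inv_eqI[OF R(1)]) auto
  then show "hermitian_mat S"
    using S by (simp add: S_def hermitian_mat_def)
qed

section \<open>The Moore-Penrose pseudoinverse\<close>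

text \<open>Here A Y = (A X)(A Y) with all three matrices Hermitian, so taking adjoints gives A Y =
  (A Y)(A X) = A X; likewise Y A = X A. Then X = X A X = Y A X = Y A Y = Y.\<close>

lemma Penrose_unique:
  assumes A: "A \<in> carrier_mat m n" and X: "X \<in> carrier_mat n m" and Y: "Y \<in> carrier_mat n m"
    and PX: "A * X * A = A" "X * A * X = X" "hermitian_mat (A * X)" "hermitian_mat (X * A)"
    and PY: "A * Y * A = A" "Y * A * Y = Y" "hermitian_mat (A * Y)" "hermitian_mat (Y * A)"
  shows "X = Y"
proof -
  have AX: "A * X \<in> carrier_mat m m" "A * Y \<in> carrier_mat m m" "X * A \<in> carrier_mat n n" "Y * A \<in> carrier_mat n n"
    using A X Y by auto
  have "A * Y = A * X * A * Y" using PX(1) by simp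
  also have "\<dots> = (A * X) * (A * Y)" by (rule assoc_mult_mat) (use A X Y in auto)
  finally have "A * Y = mat_adjoint ((A * X) * (A * Y))"
    using PY(3) by (metis hermitian_mat_def)
  also have "\<dots> = (A * Y) * (A * X)"
    using PX(3) PY(3) by (simp add: mat_adjoint_mult[OF AX(1,2)] hermitian_mat_def)
  also have "\<dots> = A * Y * A * X" by (rule assoc_mult_mat[symmetric]) (use A X Y in auto)
  finally have 1: "A * Y = A * X" using PY(1) by simp
  have "Y * A = Y * (A * X * A)" using PX(1) by simp
  also have "\<dots> = Y * (A * (X * A))"
    by (rule arg_cong[of _ _ "(*) Y"], rule assoc_mult_mat) (use A X Y in auto)
  also have "\<dots> = (Y * A) * (X * A)"
    by (rule assoc_mult_mat[symmetric]) (use A X Y in auto)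
  finally have "Y * A = mat_adjoint ((Y * A) * (X * A))"
    using PY(4) by (metis hermitian_mat_def)
  also have "\<dots> = (X * A) * (Y * A)"
    using PX(4) PY(4) by (simp add: mat_adjoint_mult[OF AX(4,3)] hermitian_mat_def)
  also have "\<dots> = X * (A * (Y * A))"
    by (rule assoc_mult_mat) (use A X Y in auto)
  also have "\<dots> = X * (A * Y * A)"
    by (rule arg_cong[of _ _ "(*) X"], rule assoc_mult_mat[symmetric]) (use A X Y in auto)
  finally have 2: "Y * A = X * A" using PY(1) by simp
  have "X = X * A * X" using PX by simp
  also have "\<dots> = Y * A * X" using 2 by simp
  also have "\<dots> = Y * (A * X)" by (rule assoc_mult_mat) (use A X Y in auto)
  also have "\<dots> = Y * (A * Y)" using 1 by simp
  also have "\<dots> = Y * A * Y" by (rule assoc_mult_mat[symmetric]) (use A X Y in auto)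
  finally show ?thesis using PY by simp
qed

text \<open>Since \<open>inverse 0 = 0\<close>, inverting the eigenvalues entrywise keeps the zero
  ones at zero, which is the pseudoinverse of a diagonal matrix.\<close>

lemma pinv_unitary_diagonal:
  fixes d :: "nat \<Rightarrow> real"
  assumes U: "U \<in> carrier_mat n n" "mat_adjoint U * U = 1\<^sub>m n"
    and A: "A = U * mat_diag n (\<lambda>k. complex_of_real (d k)) * mat_adjoint U"
  shows "pinv A = U * mat_diag n (\<lambda>k. complex_of_real (inverse (d k))) * mat_adjoint U"
proof -
  \<comment> \<open>\<open>c\<close> is multiplicative with Hermitian values, so the Penrose
    equations become identities between real numbers.\<close>
  define c where "c f = U * mat_diag n (\<lambda>k. complex_of_real (f k)) * mat_adjoint U" for f
  have cc: "c f * c g = c (\<lambda>k. f k * g k)" for f g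
    unfolding c_def by (subst unitary_conjugation_mult[OF U]) auto
  have cC: "c f \<in> carrier_mat n n" for f using U by (auto simp: c_def)
  have ch: "hermitian_mat (c f)" for f
    using hermitian_mat_congruence[of "mat_diag n (\<lambda>k. complex_of_real (f k))" n "mat_adjoint U" n] U
    by (simp add: c_def hermitian_mat_def mat_adjoint_mat_diag)
  have Ac: "A = c d" by (simp add: A c_def)
  let ?X = "c (\<lambda>k. inverse (d k))"
  have P: "?X \<in> carrier_mat (dim_col A) (dim_row A) \<and>
     A * ?X * A = A \<and> ?X * A * ?X = ?X \<and> hermitian_mat (A * ?X) \<and> hermitian_mat (?X * A)"
  proof -
    have "d k * inverse (d k) * d k = d k" "inverse (d k) * d k * inverse (d k) = inverse (d k)" for k
      by (cases "d k = 0"; simp)+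
    moreover have "?X \<in> carrier_mat (dim_col A) (dim_row A)"
      using cC carrier_matD[OF cC[of d]] by (simp add: Ac)
    ultimately show ?thesis by (simp only: Ac cc ch simp_thms)
  qed
  have "pinv A = ?X"
    unfolding pinv_def
  proof (rule the_equality)
    fix Y assume Y: "Y \<in> carrier_mat (dim_col A) (dim_row A) \<and>
     A * Y * A = A \<and> Y * A * Y = Y \<and> hermitian_mat (A * Y) \<and> hermitian_mat (Y * A)"
    have "A \<in> carrier_mat n n" using cC by (simp only: Ac)
    moreover from this have "Y \<in> carrier_mat n n" using Y by (metis carrier_matD)
    ultimately show "Y = ?X"
      by (rule Penrose_unique[OF _ _ cC]) (use P Y in blast)+
  qed (rule P)
  then show ?thesis by (simp add: c_def)
qed

section \<open>Rank of a diagonalized matrix\<close>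

lemma (in vec_space) col_space_mult_subset:
  assumes "A \<in> carrier_mat n m" "C \<in> carrier_mat m l"
  shows "col_space (A * C) \<subseteq> col_space A"
proof
  fix y assume "y \<in> col_space (A * C)"
  then obtain x where x: "x \<in> carrier_vec l" "(A * C) *\<^sub>v x = y"
    using assms col_space_eq[of "A * C" l] by auto
  then have "y = A *\<^sub>v (C *\<^sub>v x)"
    using assms by (metis assoc_mult_mat_vec)
  moreover have "C *\<^sub>v x \<in> carrier_vec m" "A *\<^sub>v (C *\<^sub>v x) \<in> carrier_vec n"
    using assms x by (meson mult_mat_vec_carrier)+
  ultimately show "y \<in> col_space A"
    using assms by (subst col_space_eq[OF assms(1)]) auto
qed

text \<open>The column space is that of the matrix keeping the columns of \<open>U\<close> with \<open>d k \<noteq> 0\<close> and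
  zeroing out the others.\<close>

lemma rank_unitary_diagonal:
  fixes U :: "complex mat" and d :: "nat \<Rightarrow> complex"
  assumes U: "U \<in> carrier_mat n n" "mat_adjoint U * U = 1\<^sub>m n"
  shows "vec_space.rank n (U * mat_diag n d * mat_adjoint U) = card {k. k < n \<and> d k \<noteq> 0}"
proof -
  define A where "A = U * mat_diag n d * mat_adjoint U"
  define e where "e k = (if d k = 0 then 0 else 1 :: complex)" for k
  define V where "V = U * mat_diag n e"
  have c: "A \<in> carrier_mat n n" "V \<in> carrier_mat n n" "mat_adjoint U \<in> carrier_mat n n"
    using U by (auto simp: A_def V_def)
  have AV: "A = V * (mat_diag n d * mat_adjoint U)"
  proof -
    have "V * (mat_diag n d * mat_adjoint U) = U * (mat_diag n e * mat_diag n d) * mat_adjoint U"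
      unfolding V_def using U(1) by (simp add: assoc_mult_mat[of _ n n _ n _ n] mult_carrier_mat[of _ n n _ n] del: mat_diag_diag)
    also have "mat_diag n e * mat_diag n d = mat_diag n d"
      unfolding mat_diag_diag by (rule arg_cong[of _ _ "mat_diag n"]) (auto simp: e_def)
    finally show ?thesis by (simp add: A_def)
  qed
  \<comment> \<open>Again \<open>inverse 0 = 0\<close>: the nonzero eigenvalues become 1 and the
    zero ones stay. Thus \<open>A\<close> and \<open>V\<close> are right multiples of each other and
    have the same column space.\<close>
  have VA: "V = A * (U * mat_diag n (\<lambda>k. inverse (d k)))"
  proof -
    have "A * (U * mat_diag n (\<lambda>k. inverse (d k))) =
        U * mat_diag n d * (mat_adjoint U * U) * mat_diag n (\<lambda>k. inverse (d k))"
      unfolding A_def using U(1) by (simp add: assoc_mult_mat[of _ n n _ n _ n] mult_carrier_mat[of _ n n _ n] del: mat_diag_diag)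
    also have "\<dots> = U * (mat_diag n d * mat_diag n (\<lambda>k. inverse (d k)))"
      unfolding U(2) using U(1) by (simp add: left_mult_one_mat[of _ n n] assoc_mult_mat[of _ n n _ n _ n] mult_carrier_mat[of _ n n _ n] del: mat_diag_diag)
    also have "mat_diag n d * mat_diag n (\<lambda>k. inverse (d k)) = mat_diag n e"
      unfolding mat_diag_diag by (rule arg_cong[of _ _ "mat_diag n"]) (auto simp: e_def)
    finally show ?thesis by (simp add: V_def)
  qed
  interpret vec_space "TYPE(complex)" n .
  have "col_space A = col_space V"
    using AV VA col_space_mult_subset[OF c(2), of "mat_diag n d * mat_adjoint U" n]
      col_space_mult_subset[OF c(1), of "U * mat_diag n (\<lambda>k. inverse (d k))" n] c(3) U(1)
    by (metis mat_diag_dim mult_carrier_mat subset_antisym)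
  then have "rank A = rank V"
    by (simp add: rank_def col_space_def)
  define S where "S = col U ` {k. k < n \<and> d k \<noteq> 0}"
  have Vcol: "col V k = (if d k = 0 then 0\<^sub>v n else col U k)" if "k < n" for k
    using U(1) that unfolding V_def mat_diag_mult_right[OF U(1)] by (intro eq_vecI) (auto simp: e_def)
  have cols: "set (cols M) = col M ` {..<n}" if "M \<in> carrier_mat n n" for M :: "complex mat"
    using that by (auto simp: cols_def)
  \<comment> \<open>Invertibility of \<open>U\<close> makes its columns distinct and independent, so
    counting columns in \<open>S\<close> is counting indices.\<close>
  have "det (mat_adjoint U) * det U = 1"
    using det_mult[OF c(3) U(1)] U(2) by simp
  then have "det U \<noteq> 0" by auto
  then have rU: "rank U = n" using det_rank_iff[OF U(1)] by simp
  then have dist: "distinct (cols U)"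
    using non_distinct_low_rank[OF U(1)] by fastforce
  have indpt: "lin_indpt (set (cols U))"
    by (rule full_rank_lin_indpt[OF U(1) rU dist])
  have SU: "S \<subseteq> set (cols U)" using cols[OF U(1)] by (auto simp: S_def)
  have inj: "inj_on (col U) {..<n}"
    using dist U(1) by (auto simp: cols_def distinct_map atLeast0LessThan)
  have "card S = card {k. k < n \<and> d k \<noteq> 0}"
    unfolding S_def by (rule card_image, rule inj_on_subset[OF inj]) auto
  moreover have "rank V = card S"
  proof (rule rank_card_indpt[OF c(2)])
    \<comment> \<open>The only possible column of \<open>V\<close> outside \<open>S\<close> is zero,
      which no independent set contains; hence \<open>S\<close> is maximal.\<close>
    have SV: "S \<subseteq> set (cols V)" "set (cols V) \<subseteq> insert (0\<^sub>v n) S"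
      using cols[OF c(2)] Vcol by (auto simp: S_def)
    show "maximal S (\<lambda>T. T \<subseteq> set (cols V) \<and> lin_indpt T)"
      unfolding maximal_def
    proof (intro conjI allI impI)
      show "S \<subseteq> set (cols V)" by (rule SV)
      show "lin_indpt S" by (rule subset_li_is_li[OF indpt SU])
      fix T assume T: "S \<subseteq> T \<and> T \<subseteq> set (cols V) \<and> lin_indpt T"
      then have "T \<subseteq> carrier_vec n" using cols_dim[of V] c(2) by auto
      then have "0\<^sub>v n \<notin> T"
        using T vs_zero_lin_dep[of T] by simp
      then show "T = S" using T SV by auto
    qed
  qed
  ultimately show ?thesis
    using \<open>rank A = rank V\<close> by (simp add: A_def)
qed

section \<open>The secular equation\<close>

text \<open>One nonzero coefficient suffices for strictness. Positivity of \<mu> keeps every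
  denominator positive, so the terms with \<open>lam k = 0\<close> decrease too.\<close>

lemma secular_sum_strict_antimono:
  fixes c lam :: "nat \<Rightarrow> real"
  assumes "0 < \<mu>" "\<mu> < \<nu>" "\<And>k. k < n \<Longrightarrow> 0 \<le> lam k" "j < n" "c j \<noteq> 0"
  shows "(\<Sum>k<n. (c k)\<^sup>2 / (lam k + \<nu>)\<^sup>2) < (\<Sum>k<n. (c k)\<^sup>2 / (lam k + \<mu>)\<^sup>2)"
proof (rule sum_strict_mono_ex1)
  have pos: "0 < (lam k + \<mu>)\<^sup>2" "(lam k + \<mu>)\<^sup>2 < (lam k + \<nu>)\<^sup>2" "0 < (lam k + \<nu>)\<^sup>2"
    if "k < n" for k
    using assms(1,2) assms(3)[OF that] by (auto intro!: power_strict_mono simp: add_nonneg_eq_0_iff)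
  show "\<forall>k\<in>{..<n}. (c k)\<^sup>2 / (lam k + \<nu>)\<^sup>2 \<le> (c k)\<^sup>2 / (lam k + \<mu>)\<^sup>2"
  proof
    fix k assume "k \<in> {..<n}"
    then show "(c k)\<^sup>2 / (lam k + \<nu>)\<^sup>2 \<le> (c k)\<^sup>2 / (lam k + \<mu>)\<^sup>2"
      by (intro divide_left_mono mult_pos_pos less_imp_le[OF pos(2)] pos) auto
  qed
  show "\<exists>k\<in>{..<n}. (c k)\<^sup>2 / (lam k + \<nu>)\<^sup>2 < (c k)\<^sup>2 / (lam k + \<mu>)\<^sup>2"
    using assms(4,5) by (intro bexI[of _ j] divide_strict_left_mono mult_pos_pos pos) auto
qed simp

lemma L2_set_power2: "(L2_set c A)\<^sup>2 = (\<Sum>k\<in>A. (c k)\<^sup>2)"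
  by (simp add: L2_set_def sum_nonneg)

text \<open>The lower bound \<open>l\<close> is asked for only where \<open>c k\<close> is nonzero.
  It may therefore be the least positive eigenvalue when the tail of \<open>c\<close> vanishes, even
  if some \<open>lam k\<close> are 0.\<close>

lemma secular_sum_le:
  fixes c lam :: "nat \<Rightarrow> real"
  assumes "0 < l + \<mu>" "\<And>k. k < n \<Longrightarrow> c k \<noteq> 0 \<Longrightarrow> l \<le> lam k"
  shows "(\<Sum>k<n. (c k)\<^sup>2 / (lam k + \<mu>)\<^sup>2) \<le> (L2_set c {..<n} / (l + \<mu>))\<^sup>2"
proof -
  have "(c k)\<^sup>2 / (lam k + \<mu>)\<^sup>2 \<le> (c k)\<^sup>2 / (l + \<mu>)\<^sup>2" if "k < n" for k
  proof (cases "c k = 0")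
    case False
    then have "0 < l + \<mu>" "l + \<mu> \<le> lam k + \<mu>"
      using assms(1) assms(2)[OF that] by auto
    then show ?thesis by (intro divide_left_mono power_mono mult_pos_pos) auto
  qed simp
  then show ?thesis
    by (auto simp: power_divide L2_set_power2 sum_divide_distrib intro!: sum_mono)
qed

lemma secular_root_bounds:
  fixes c lam :: "nat \<Rightarrow> real"
  assumes "0 < P" "0 < \<mu>" "(\<Sum>k<n. (c k)\<^sup>2 / (lam k + \<mu>)\<^sup>2) = P"
    and "\<And>k. k < n \<Longrightarrow> 0 \<le> lam k"
    and "\<And>k. k < n \<Longrightarrow> lam k \<le> u" "\<And>k. k < n \<Longrightarrow> c k \<noteq> 0 \<Longrightarrow> l \<le> lam k" "0 \<le> l"
  shows "L2_set c {..<n} / sqrt P - u \<le> \<mu>" "\<mu> \<le> L2_set c {..<n} / sqrt P - l"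
proof -
  let ?L = "L2_set c {..<n}"
  \<comment> \<open>An empty sum could not equal the positive \<open>P\<close>; the index 0 then
    shows that \<open>u\<close> is nonnegative.\<close>
  have "n \<noteq> 0" using assms(1,3) by (intro notI) auto
  then have u: "0 \<le> u" using assms(4,5)[of 0] by simp
  have "(?L / (u + \<mu>))\<^sup>2 = (\<Sum>k<n. (c k)\<^sup>2 / (u + \<mu>)\<^sup>2)"
    by (simp add: power_divide L2_set_power2 sum_divide_distrib)
  also have "\<dots> \<le> (\<Sum>k<n. (c k)\<^sup>2 / (lam k + \<mu>)\<^sup>2)"
  proof (intro sum_mono divide_left_mono power_mono mult_pos_pos)
    fix k assume "k \<in> {..<n}"
    then have "0 < u + \<mu>" "0 < lam k + \<mu>" "lam k \<le> u"
      using assms(2,4,5) u by (simp_all add: add_nonneg_pos)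
    then show "0 < (u + \<mu>)\<^sup>2" "0 < (lam k + \<mu>)\<^sup>2" "lam k + \<mu> \<le> u + \<mu>" "0 \<le> lam k + \<mu>"
      by simp_all
  qed simp
  finally have "(?L / (u + \<mu>))\<^sup>2 \<le> P" using assms(3) by simp
  then have "?L / (u + \<mu>) \<le> sqrt P" by (rule real_le_rsqrt)
  then show "?L / sqrt P - u \<le> \<mu>"
    using assms(1,2) u by (simp add: field_simps add_nonneg_pos)
  have "P \<le> (?L / (l + \<mu>))\<^sup>2"
    using secular_sum_le[of l \<mu> n c lam] assms by (simp add: add_nonneg_pos)
  then have "sqrt P \<le> ?L / (l + \<mu>)"
    using assms(2,7) by (intro real_le_lsqrt) (auto simp: L2_set_nonneg)
  then show "\<mu> \<le> ?L / sqrt P - l"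
    using assms(1,2,7) by (simp add: field_simps add_nonneg_pos)
qed

text \<open>Intermediate value theorem on an interval ending at the norm of \<open>c\<close> over
  \<open>sqrt P\<close>, where the sum is at most \<open>P\<close>. The left end is 0 if the tail of
  \<open>c\<close> vanishes, and otherwise a point where one term with \<open>lam k = 0\<close>
  alone reaches \<open>P\<close>.\<close>

lemma secular_root_exists:
  fixes c lam :: "nat \<Rightarrow> real"
  assumes P: "0 < P" and r: "r \<le> n"
    and lam: "\<And>k. k < r \<Longrightarrow> 0 < lam k" "\<And>k. r \<le> k \<Longrightarrow> k < n \<Longrightarrow> lam k = 0"
    and c: "\<And>k. k < n \<Longrightarrow> 0 \<le> c k"
    and cases: "(\<exists>k\<in>{r..<n}. c k \<noteq> 0) \<or>
      (\<forall>k\<in>{r..<n}. c k = 0) \<and> (\<Sum>k<r. (c k)\<^sup>2 / (lam k)\<^sup>2) > P"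
  shows "\<exists>!\<mu>. \<mu> > 0 \<and> (\<Sum>k<n. (c k)\<^sup>2 / (lam k + \<mu>)\<^sup>2) = P"
proof -
  define h where "h \<mu> = (\<Sum>k<n. (c k)\<^sup>2 / (lam k + \<mu>)\<^sup>2)" for \<mu>
  define b where "b = L2_set c {..<n} / sqrt P"
  have lam0: "0 \<le> lam k" if "k < n" for k
    using lam[of k] that by (cases "k < r") auto
  obtain j where j: "j < n" "c j \<noteq> 0"
  proof (cases "\<exists>k\<in>{r..<n}. c k \<noteq> 0")
    case False
    then have "(\<Sum>k<r. (c k)\<^sup>2 / (lam k)\<^sup>2) \<noteq> 0" using cases P by auto
    then obtain k where "k < r" "(c k)\<^sup>2 / (lam k)\<^sup>2 \<noteq> 0"
      by (meson lessThan_iff sum.neutral)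
    then show ?thesis using that[of k] r by auto
  qed (use that in auto)
  then have "0 < (\<Sum>k<n. (c k)\<^sup>2)" by (intro sum_pos2[of _ j]) auto
  then have b: "0 < b" unfolding b_def L2_set_def using P by simp
  have hb: "h b \<le> P"
  proof -
    have "h b \<le> (L2_set c {..<n} / (0 + b))\<^sup>2"
      unfolding h_def using b lam0 by (intro secular_sum_le) auto
    also have "\<dots> = P"
      using b P by (auto simp: b_def power_divide)
    finally show ?thesis .
  qed
  have "\<exists>\<mu>. \<mu> > 0 \<and> h \<mu> = P"
  proof (cases "\<exists>k\<in>{r..<n}. c k \<noteq> 0")
    case True
    then obtain k where k: "r \<le> k" "k < n" "c k \<noteq> 0" by auto
    \<comment> \<open>As \<open>lam k = 0\<close>, the term of index \<open>k\<close> equals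
      \<open>P\<close> exactly at this point.\<close>
    define a where "a = c k / sqrt P"
    have a: "0 < a" using k c[of k] P by (simp add: a_def)
    have "P = (c k)\<^sup>2 / (lam k + a)\<^sup>2"
      using k P lam(2)[of k] by (simp add: a_def power_divide)
    also have "\<dots> \<le> h a"
      unfolding h_def using k by (intro member_le_sum) auto
    finally have ha: "P \<le> h a" .
    have "a \<le> b"
      unfolding a_def b_def using member_le_L2_set[of "{..<n}" k c] k P by (intro divide_right_mono) auto
    moreover have "continuous_on {a..b} h"
      unfolding h_def using a lam0 by (intro continuous_intros ballI) (auto simp: add_nonneg_eq_0_iff)
    ultimately obtain x where "a \<le> x" "h x = P"
      using IVT2'[of h b P a] hb ha by auto
    then show ?thesis using a by (intro exI[of _ x]) auto
  next
    case False
    \<comment> \<open>The dropped terms have numerator 0. The remaining denominators do not vanish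
      at 0, which gives continuity on an interval that includes 0.\<close>
    have h: "h \<mu> = (\<Sum>k<r. (c k)\<^sup>2 / (lam k + \<mu>)\<^sup>2)" for \<mu>
      unfolding h_def using False r by (intro sum.mono_neutral_right) (auto simp: not_less)
    have h0: "P < h 0" using False cases unfolding h by simp
    have "continuous_on {0..b} h"
      unfolding h using lam(1) by (intro continuous_intros ballI) (fastforce simp: add_nonneg_eq_0_iff)
    then obtain x where "0 \<le> x" "h x = P"
      using IVT2'[of h b P 0] hb h0 b by auto
    moreover have "x \<noteq> 0" using h0 \<open>h x = P\<close> by auto
    ultimately show ?thesis by (intro exI[of _ x]) auto
  qed
  moreover have "\<mu> = \<nu>" if "\<mu> > 0" "h \<mu> = P" "\<nu> > 0" "h \<nu> = P" for \<mu> \<nu>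
    using secular_sum_strict_antimono[of \<mu> \<nu> n lam j c] secular_sum_strict_antimono[of \<nu> \<mu> n lam j c]
      that lam0 j unfolding h_def by (cases \<mu> \<nu> rule: linorder_cases) auto
  ultimately show ?thesis unfolding h_def by blast
qed

section \<open>The minimization problem\<close>

lemma complete_square:
  fixes y p :: complex
  assumes "a > 0"
  shows "a * (cmod y)\<^sup>2 - 2 * Re (cnj p * y) = a * (cmod (y - p / complex_of_real a))\<^sup>2 - (cmod p)\<^sup>2 / a"
proof -
  have "a * (cmod (y - p / complex_of_real a))\<^sup>2 = a * ((Re y - Re p / a)\<^sup>2 + (Im y - Im p / a)\<^sup>2)"
    by (simp add: cmod_power2)
  also have "\<dots> = a * ((Re y)\<^sup>2 + (Im y)\<^sup>2) - 2 * (Re p * Re y + Im p * Im y) + ((Re p)\<^sup>2 + (Im p)\<^sup>2) / a"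
    using assms by (simp add: field_simps power2_eq_square)
  finally show ?thesis by (simp add: cmod_power2)
qed

text \<open>The Lagrangian \<open>\<Sum> (\<lambda>\<^sub>k + \<mu>) |y\<^sub>k|\<^sup>2 - 2 Re (p\<^sub>k\<^sup>* y\<^sub>k)\<close> is a sum of squares around
  \<open>y\<^sub>k = p\<^sub>k / (\<lambda>\<^sub>k + \<mu>)\<close>, up to a constant.\<close>

lemma diagonal_minimizer_active:
  fixes y p :: "nat \<Rightarrow> complex" and lam :: "nat \<Rightarrow> real"
  assumes \<mu>: "\<mu> > 0" and lam: "\<And>k. k < n \<Longrightarrow> 0 \<le> lam k"
    and P: "(\<Sum>k<n. (cmod (p k))\<^sup>2 / (lam k + \<mu>)\<^sup>2) = P"
    and z: "\<And>k. k < n \<Longrightarrow> z k = p k / complex_of_real (lam k + \<mu>)"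
    and y: "(\<Sum>k<n. (cmod (y k))\<^sup>2) \<le> P"
    and le: "(\<Sum>k<n. lam k * (cmod (y k))\<^sup>2 - 2 * Re (cnj (p k) * y k)) \<le>
      (\<Sum>k<n. lam k * (cmod (z k))\<^sup>2 - 2 * Re (cnj (p k) * z k))"
    and k: "k < n"
  shows "y k = z k"
proof -
  define C where "C = (\<Sum>k<n. (cmod (p k))\<^sup>2 / (lam k + \<mu>))"
  have pos: "0 < lam k + \<mu>" if "k < n" for k using \<mu> lam[OF that] by simp
  \<comment> \<open>At \<open>w = z\<close> the squares vanish and the norm term is \<mu> times
    \<open>P\<close>. A feasible \<open>y\<close> that does no worse than \<open>z\<close> thus
    leaves no room for a positive square.\<close>
  have obj: "(\<Sum>k<n. lam k * (cmod (w k))\<^sup>2 - 2 * Re (cnj (p k) * w k)) =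
      (\<Sum>k<n. (lam k + \<mu>) * (cmod (w k - z k))\<^sup>2) - C - \<mu> * (\<Sum>k<n. (cmod (w k))\<^sup>2)" for w
    unfolding C_def sum_distrib_left sum_subtractf[symmetric]
  proof (intro sum.cong refl)
    fix k assume "k \<in> {..<n}"
    then show "lam k * (cmod (w k))\<^sup>2 - 2 * Re (cnj (p k) * w k) =
      (lam k + \<mu>) * (cmod (w k - z k))\<^sup>2 - (cmod (p k))\<^sup>2 / (lam k + \<mu>) - \<mu> * (cmod (w k))\<^sup>2"
      using complete_square[OF pos, of k "w k" "p k"] z[of k] by (simp add: algebra_simps)
  qed
  have "(\<Sum>k<n. (cmod (z k))\<^sup>2) = P"
    unfolding P[symmetric]
    using pos by (intro sum.cong) (auto simp: z norm_divide power_divide simp del: of_real_add)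
  then have "(\<Sum>k<n. (lam k + \<mu>) * (cmod (y k - z k))\<^sup>2) \<le> \<mu> * ((\<Sum>k<n. (cmod (y k))\<^sup>2) - P)"
    using le unfolding obj by (simp add: algebra_simps)
  also have "\<dots> \<le> 0" using \<mu> y by (simp add: mult_nonneg_nonpos)
  finally have "(\<Sum>k<n. (lam k + \<mu>) * (cmod (y k - z k))\<^sup>2) = 0"
    using pos by (intro antisym sum_nonneg) (auto simp: less_imp_le)
  then have "(lam k + \<mu>) * (cmod (y k - z k))\<^sup>2 = 0"
    using pos k by (subst (asm) sum_nonneg_eq_0_iff) (auto simp: less_imp_le)
  then show ?thesis using pos[OF k] by simp
qed

text \<open>Each coordinate is minimized separately. Where \<open>lam k = 0\<close> the linear
  coefficient vanishes as well, so every value is optimal and \<open>inverse 0 = 0\<close> selects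
  the one of least modulus.\<close>

lemma diagonal_minimizer_unconstrained:
  fixes y p :: "nat \<Rightarrow> complex" and lam :: "nat \<Rightarrow> real"
  assumes lam: "\<And>k. k < n \<Longrightarrow> 0 \<le> lam k" "\<And>k. k < n \<Longrightarrow> lam k = 0 \<Longrightarrow> p k = 0"
    and z: "\<And>k. k < n \<Longrightarrow> z k = complex_of_real (inverse (lam k)) * p k"
  shows "(\<Sum>k<n. lam k * (cmod (z k))\<^sup>2 - 2 * Re (cnj (p k) * z k)) \<le>
      (\<Sum>k<n. lam k * (cmod (y k))\<^sup>2 - 2 * Re (cnj (p k) * y k))"
proof (rule sum_mono)
  fix k assume "k \<in> {..<n}"
  then have k: "k < n" by simp
  show "lam k * (cmod (z k))\<^sup>2 - 2 * Re (cnj (p k) * z k) \<le> lam k * (cmod (y k))\<^sup>2 - 2 * Re (cnj (p k) * y k)"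
  proof (cases "lam k = 0")
    case True
    then show ?thesis using lam(2)[OF k] by simp
  next
    case False
    then have pos: "0 < lam k" using lam(1)[OF k] by simp
    have "z k = p k / complex_of_real (lam k)"
      using z[OF k] by (simp add: field_simps)
    then show ?thesis
      using complete_square[OF pos, of "z k" "p k"] complete_square[OF pos, of "y k" "p k"] pos by simp
  qed
qed

section \<open>Change of variables to the diagonal problem\<close>

text \<open>The two linear terms merge into one with the vector B^H g - q, the right-hand side of
  both solution formulas.\<close>

lemma P2_objective_eq:
  assumes B: "B \<in> carrier_mat m n" and q: "q \<in> carrier_vec n" and g: "g \<in> carrier_vec m" and x: "x \<in> carrier_vec n"
  shows "P2_objective Q B q g x =
    Re (conjugate x \<bullet> (Q *\<^sub>v x)) - 2 * Re (conjugate (mat_adjoint B *\<^sub>v g - q) \<bullet> x)"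
proof -
  have Bg: "mat_adjoint B *\<^sub>v g \<in> carrier_vec n"
    using B g by (meson mat_adjoint_carrier mult_mat_vec_carrier)
  have "conjugate (u - w) = conjugate u - conjugate w" if "u \<in> carrier_vec n" "w \<in> carrier_vec n" for u w :: "complex vec"
    using that by (intro eq_vecI) auto
  from this[OF Bg q] have "conjugate (mat_adjoint B *\<^sub>v g - q) \<bullet> x = conjugate (mat_adjoint B *\<^sub>v g) \<bullet> x - conjugate q \<bullet> x"
    using Bg q x by (simp add: minus_scalar_prod_distrib[of _ n])
  then show ?thesis
    using conjugate_scalar_prod_mult_mat[OF B g x] by (simp add: P2_objective_def)
qed

text \<open>Since \<open>T\<close> diagonalizes \<open>Q\<close> and \<open>E\<close> simultaneously, \<open>x = T y\<close> separates the problem into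
  scalar ones coupled only by the constraint.\<close>

locale simultaneous_diagonalization =
  fixes n :: nat and T T' Q E :: "complex mat" and lam :: "nat \<Rightarrow> real" and b p :: "complex vec"
  assumes T: "T \<in> carrier_mat n n" "T' \<in> carrier_mat n n" "T * T' = 1\<^sub>m n"
    and Q: "Q \<in> carrier_mat n n" "mat_adjoint T * Q * T = mat_diag n (\<lambda>k. complex_of_real (lam k))"
    and E: "E \<in> carrier_mat n n" "mat_adjoint T * E * T = 1\<^sub>m n"
    and b: "b \<in> carrier_vec n" and p: "p = mat_adjoint T *\<^sub>v b"
    and lam_nonneg: "\<And>k. k < n \<Longrightarrow> 0 \<le> lam k"
begin

abbreviation diagonal_objective :: "complex vec \<Rightarrow> real" where
  "diagonal_objective y \<equiv> (\<Sum>k<n. lam k * (cmod (y $ k))\<^sup>2 - 2 * Re (cnj (p $ k) * y $ k))"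

lemma T'T: "T' * T = 1\<^sub>m n"
  using T by (intro mat_mult_left_right_inverse[of T n T'])

lemma p_carrier: "p \<in> carrier_vec n"
  unfolding p using T(1) b by (meson mat_adjoint_carrier mult_mat_vec_carrier)

lemma T_T':
  assumes "x \<in> carrier_vec n"
  shows "T *\<^sub>v (T' *\<^sub>v x) = x"
proof -
  have "(T * T') *\<^sub>v x = T *\<^sub>v (T' *\<^sub>v x)"
    by (rule assoc_mult_mat_vec; use T assms in simp)
  then show ?thesis
    using T(3) assms by simp
qed

lemma T'_carrier: "x \<in> carrier_vec n \<Longrightarrow> T' *\<^sub>v x \<in> carrier_vec n"
  using T(2) by (meson mult_mat_vec_carrier)

lemma T_carrier: "x \<in> carrier_vec n \<Longrightarrow> T *\<^sub>v x \<in> carrier_vec n"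
  using T(1) by (meson mult_mat_vec_carrier)

lemma objective_eq:
  assumes y: "y \<in> carrier_vec n"
  shows "Re (conjugate (T *\<^sub>v y) \<bullet> (Q *\<^sub>v (T *\<^sub>v y))) - 2 * Re (conjugate b \<bullet> (T *\<^sub>v y)) = diagonal_objective y"
proof -
  have "conjugate b \<bullet> (T *\<^sub>v y) = conjugate p \<bullet> y"
    unfolding p by (rule conjugate_scalar_prod_mult_mat[OF T(1) b y])
  also have "\<dots> = (\<Sum>k<n. cnj (p $ k) * y $ k)"
    using p_carrier y by (auto simp: scalar_prod_def atLeast0LessThan)
  finally show ?thesis
    unfolding quadratic_form_congruence[OF Q(1) T(1) y] Q(2) Re_quadratic_form_mat_diag[OF y]
    by (simp add: sum_subtractf sum_distrib_left)
qed

lemma feasible_iff: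
  assumes y: "y \<in> carrier_vec n"
  shows "P2_feasible E P (T *\<^sub>v y) \<longleftrightarrow> (\<Sum>k<n. (cmod (y $ k))\<^sup>2) \<le> P"
proof -
  have "conjugate y \<bullet> (1\<^sub>m n *\<^sub>v y) = conjugate y \<bullet> (mat_diag n (\<lambda>k. complex_of_real 1) *\<^sub>v y)"
    by simp
  then have "Re (conjugate (T *\<^sub>v y) \<bullet> (E *\<^sub>v (T *\<^sub>v y))) = (\<Sum>k<n. (cmod (y $ k))\<^sup>2)"
    unfolding quadratic_form_congruence[OF E(1) T(1) y] E(2)
    using Re_quadratic_form_mat_diag[OF y, of "\<lambda>_. 1"] by simp
  then show ?thesis
    using E(1) T_carrier[OF y] by (simp add: P2_feasible_def)
qed

lemma feasible_carrier: "P2_feasible E P x \<Longrightarrow> x \<in> carrier_vec n"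
  using E(1) by (auto simp: P2_feasible_def)

text \<open>A feasible point that does no worse than the candidate must equal it. Together with
  feasibility of the candidate this gives minimality and uniqueness, hence an equivalence.\<close>

lemma is_arg_min_active:
  assumes obj: "\<And>x. x \<in> carrier_vec n \<Longrightarrow> obj x = Re (conjugate x \<bullet> (Q *\<^sub>v x)) - 2 * Re (conjugate b \<bullet> x)"
    and \<mu>: "\<mu> > 0" and P: "(\<Sum>k<n. (cmod (p $ k))\<^sup>2 / (lam k + \<mu>)\<^sup>2) = P"
  shows "is_arg_min obj (P2_feasible E P) x \<longleftrightarrow> x = T *\<^sub>v vec n (\<lambda>k. p $ k / complex_of_real (lam k + \<mu>))"
proof -
  define z where "z = vec n (\<lambda>k. p $ k / complex_of_real (lam k + \<mu>))"
  have z: "z \<in> carrier_vec n" by (simp add: z_def)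
  have zk: "z $ k = p $ k / complex_of_real (lam k + \<mu>)" if "k < n" for k
    using that by (simp add: z_def)
  have "(\<Sum>k<n. (cmod (z $ k))\<^sup>2) = P"
    unfolding P[symmetric]
    using \<mu> lam_nonneg by (intro sum.cong) (auto simp: zk norm_divide power_divide simp del: of_real_add)
  then have fz: "P2_feasible E P (T *\<^sub>v z)" by (simp add: feasible_iff[OF z])
  have uniq: "x = T *\<^sub>v z" if fx: "P2_feasible E P x" and le: "obj x \<le> obj (T *\<^sub>v z)" for x
  proof -
    have x: "x \<in> carrier_vec n" by (rule feasible_carrier[OF fx])
    define y where "y = T' *\<^sub>v x"
    have y: "y \<in> carrier_vec n" unfolding y_def by (rule T'_carrier[OF x])
    have xy: "x = T *\<^sub>v y" unfolding y_def by (rule T_T'[OF x, symmetric])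
    have "y $ k = z $ k" if "k < n" for k
    proof (rule diagonal_minimizer_active[OF \<mu> lam_nonneg P zk _ _ that])
      show "(\<Sum>k<n. (cmod (y $ k))\<^sup>2) \<le> P" using fx feasible_iff[OF y] xy by simp
      show "diagonal_objective y \<le> diagonal_objective z"
        using le obj[OF T_carrier[OF y]] obj[OF T_carrier[OF z]] objective_eq[OF y] objective_eq[OF z] xy by simp
    qed
    then have "y = z" using y z by (intro eq_vecI) auto
    then show ?thesis using xy by simp
  qed
  show ?thesis
    unfolding z_def[symmetric] is_arg_min_def using fz uniq by (metis linorder_le_less_linear order_less_irrefl order_less_imp_le)
qed

text \<open>Only minimality is claimed: a coordinate with \<open>lam k = 0\<close> does not affect
  the objective, so slack in the constraint allows other minimizers.\<close>

lemma is_arg_min_inactive: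
  assumes obj: "\<And>x. x \<in> carrier_vec n \<Longrightarrow> obj x = Re (conjugate x \<bullet> (Q *\<^sub>v x)) - 2 * Re (conjugate b \<bullet> x)"
    and p0: "\<And>k. k < n \<Longrightarrow> lam k = 0 \<Longrightarrow> p $ k = 0"
    and P: "(\<Sum>k<n. (cmod (p $ k))\<^sup>2 / (lam k)\<^sup>2) \<le> P"
  shows "is_arg_min obj (P2_feasible E P) (T *\<^sub>v vec n (\<lambda>k. complex_of_real (inverse (lam k)) * p $ k))"
proof -
  define z where "z = vec n (\<lambda>k. complex_of_real (inverse (lam k)) * p $ k)"
  have z: "z \<in> carrier_vec n" by (simp add: z_def)
  have zk: "z $ k = complex_of_real (inverse (lam k)) * p $ k" if "k < n" for k
    using that by (simp add: z_def)
  have "(\<Sum>k<n. (cmod (z $ k))\<^sup>2) = (\<Sum>k<n. (cmod (p $ k))\<^sup>2 / (lam k)\<^sup>2)"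
    using lam_nonneg
    by (intro sum.cong) (auto simp: zk norm_mult norm_inverse field_simps power_mult_distrib power_divide inverse_eq_divide norm_divide)
  then have fz: "P2_feasible E P (T *\<^sub>v z)" using P by (simp add: feasible_iff[OF z])
  have "obj (T *\<^sub>v z) \<le> obj x" if fx: "P2_feasible E P x" for x
  proof -
    have x: "x \<in> carrier_vec n" by (rule feasible_carrier[OF fx])
    define y where "y = T' *\<^sub>v x"
    have y: "y \<in> carrier_vec n" unfolding y_def by (rule T'_carrier[OF x])
    have xy: "x = T *\<^sub>v y" unfolding y_def by (rule T_T'[OF x, symmetric])
    have "diagonal_objective z \<le> diagonal_objective y"
      using lam_nonneg p0 zk by (rule diagonal_minimizer_unconstrained)
    then show ?thesis
      using obj[OF T_carrier[OF y]] obj[OF T_carrier[OF z]] objective_eq[OF y] objective_eq[OF z] xy by simp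
  qed
  then show ?thesis
    unfolding z_def[symmetric] is_arg_min_def using fz by (auto simp: not_less)
qed

text \<open>Congruence by \<open>T\<close> turns the shifted matrix into a diagonal F with positive
  entries, so its inverse is T F^-1 T^H, and T^H b is \<open>p\<close>.\<close>

lemma shifted_inverse:
  assumes \<mu>: "\<mu> > 0"
  shows "invertible_mat (Q + complex_of_real \<mu> \<cdot>\<^sub>m E)"
    and "mat_inv (Q + complex_of_real \<mu> \<cdot>\<^sub>m E) *\<^sub>v b = T *\<^sub>v vec n (\<lambda>k. p $ k / complex_of_real (lam k + \<mu>))"
proof -
  define A where "A = Q + complex_of_real \<mu> \<cdot>\<^sub>m E"
  define F where "F = mat_diag n (\<lambda>k. complex_of_real (lam k + \<mu>))"
  define D where "D = mat_diag n (\<lambda>k. 1 / complex_of_real (lam k + \<mu>))"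
  have c: "A \<in> carrier_mat n n" "F \<in> carrier_mat n n" "D \<in> carrier_mat n n" "mat_adjoint T \<in> carrier_mat n n"
    "mat_adjoint T' \<in> carrier_mat n n"
    using Q(1) E(1) T by (auto simp: A_def F_def D_def)
  note assoc = assoc_mult_mat[of _ n n _ n _ n]
  have cc: "X * Y \<in> carrier_mat n n" if "X \<in> carrier_mat n n" "Y \<in> carrier_mat n n" for X Y :: "complex mat"
    using that by (rule mult_carrier_mat)
  have "mat_adjoint T * A * T = mat_adjoint T * Q * T + complex_of_real \<mu> \<cdot>\<^sub>m (mat_adjoint T * E * T)"
    unfolding A_def using T(1) Q(1) E(1) c(4) cc
    by (simp add: mult_add_distrib_mat[of _ n n _ n] add_mult_distrib_mat[of _ n n _ _ n] mult_smult_distrib[of _ n n _ n]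
        mult_smult_assoc_mat[of _ n n _ n])
  also have "\<dots> = F"
    unfolding Q(2) E(2) F_def by (intro eq_matI) (auto simp: mat_diag_def)
  finally have TAT: "mat_adjoint T * A * T = F" .
  have T'T'': "mat_adjoint T' * mat_adjoint T = 1\<^sub>m n"
    using mat_adjoint_mult[OF T(1,2)] T(3) by simp
  have "F * D = 1\<^sub>m n"
    using \<mu> lam_nonneg unfolding F_def D_def mat_diag_diag
    by (intro eq_matI) (auto simp: mat_diag_def add_nonneg_eq_0_iff simp flip: of_real_add)
  \<comment> \<open>\<open>T\<close> need not be unitary, so the congruence is undone with
    \<open>T'\<close> and its adjoint.\<close>
  have "A = (mat_adjoint T' * mat_adjoint T) * A * (T * T')"
    unfolding T'T'' T(3) using c by simp
  also have "\<dots> = mat_adjoint T' * (mat_adjoint T * A * T) * T'"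
    using c T(1,2) by (simp add: assoc cc)
  finally have A: "A = mat_adjoint T' * F * T'" unfolding TAT .
  have "A * (T * D * mat_adjoint T) = mat_adjoint T' * F * (T' * T) * D * mat_adjoint T"
    unfolding A using c T(1,2) by (simp add: assoc cc)
  also have "\<dots> = mat_adjoint T' * (F * D) * mat_adjoint T"
    unfolding T'T using c by (simp add: assoc cc left_mult_one_mat[of _ n n])
  also have "\<dots> = 1\<^sub>m n"
    unfolding \<open>F * D = 1\<^sub>m n\<close> using c T'T'' by simp
  finally have inv: "A * (T * D * mat_adjoint T) = 1\<^sub>m n" .
  have c': "T * D * mat_adjoint T \<in> carrier_mat n n" using c T(1) by (simp add: cc)
  show "invertible_mat (Q + complex_of_real \<mu> \<cdot>\<^sub>m E)"
    unfolding A_def[symmetric] by (rule mat_inv_eqI(2)[OF c(1) c' inv])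
  have "mat_inv A *\<^sub>v b = (T * D * mat_adjoint T) *\<^sub>v b"
    using mat_inv_eqI(1)[OF c(1) c' inv] by simp
  also have "\<dots> = (T * D) *\<^sub>v p"
    unfolding p by (rule assoc_mult_mat_vec) (use c T(1) b cc in auto)
  also have "\<dots> = T *\<^sub>v (D *\<^sub>v p)"
    by (rule assoc_mult_mat_vec) (use c T(1) p_carrier in auto)
  also have "D *\<^sub>v p = vec n (\<lambda>k. p $ k / complex_of_real (lam k + \<mu>))"
    unfolding D_def mat_diag_mult_vec[OF p_carrier] by simp
  finally show "mat_inv (Q + complex_of_real \<mu> \<cdot>\<^sub>m E) *\<^sub>v b = T *\<^sub>v vec n (\<lambda>k. p $ k / complex_of_real (lam k + \<mu>))"
    by (simp add: A_def)
qed

end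

section \<open>Definiteness and dimensions of the matrices of the problem\<close>

lemma matC_eq_kronecker_transpose:
  assumes "hermitian_mat (Sig i)"
  shows "matC Sig Hm G i = kronecker (transpose_mat (Sig i)) (mat_adjoint (Hm i) * G * mat_adjoint G * Hm i)"
  using hermitian_mat_cnj[OF assms] by (simp add: matC_def)

text \<open>Regroups the product as Y^H Y with Y = G^H H, the shape required of the second Kronecker
  factor.\<close>

lemma gram_product:
  fixes H G :: "complex mat"
  assumes "H \<in> carrier_mat m d" "G \<in> carrier_mat m k"
  shows "mat_adjoint H * G * mat_adjoint G * H = mat_adjoint (mat_adjoint G * H) * (mat_adjoint G * H)"
proof -
  have "mat_adjoint (mat_adjoint G * H) = mat_adjoint H * G"
    using assms mat_adjoint_mult[of "mat_adjoint G" k m H d] by simp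
  then show ?thesis
    using assms by (simp only:) (rule assoc_mult_mat[of _ d k _ m _ d], auto intro: mult_carrier_mat[of _ d m])
qed

lemma psd_matA_add_matC:
  assumes X: "Km i * Sigs * mat_adjoint (Km i) \<in> carrier_mat a a" "psd_mat (Km i * Sigs * mat_adjoint (Km i))"
    and Sig: "Sig i \<in> carrier_mat a a" "psd_mat (Sig i)"
    and H: "Hm i \<in> carrier_mat m d" and G: "G \<in> carrier_mat m k"
  shows "matA Km Sigs Hm G i i + matC Sig Hm G i \<in> carrier_mat (a * d) (a * d)"
    "psd_mat (matA Km Sigs Hm G i i + matC Sig Hm G i)"
proof -
  let ?Y = "mat_adjoint G * Hm i"
  have Y: "?Y \<in> carrier_mat k d" "mat_adjoint ?Y * ?Y \<in> carrier_mat d d"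
    using G H by (auto intro!: mult_carrier_mat[of _ d k _ d] mult_carrier_mat[of _ k m _ d])
  have eq: "matA Km Sigs Hm G i i = kronecker (transpose_mat (Km i * Sigs * mat_adjoint (Km i))) (mat_adjoint ?Y * ?Y)"
    "matC Sig Hm G i = kronecker (transpose_mat (Sig i)) (mat_adjoint ?Y * ?Y)"
    using Sig matC_eq_kronecker_transpose[of Sig i] gram_product[OF H G] by (simp_all add: matA_def psd_mat_def)
  have t: "transpose_mat (Km i * Sigs * mat_adjoint (Km i)) \<in> carrier_mat a a" "transpose_mat (Sig i) \<in> carrier_mat a a"
    using X(1) Sig(1) by (metis transpose_carrier_mat)+
  have c: "matA Km Sigs Hm G i i \<in> carrier_mat (a * d) (a * d)" "matC Sig Hm G i \<in> carrier_mat (a * d) (a * d)"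
    unfolding eq by (rule kronecker_carrier[OF _ Y(2)], rule t)+
  moreover have "psd_mat (matA Km Sigs Hm G i i)" "psd_mat (matC Sig Hm G i)"
    unfolding eq
    using psd_mat_kronecker_gram[OF t(1) Y(1) psd_mat_transpose[OF X(2)]]
      psd_mat_kronecker_gram[OF t(2) Y(1) psd_mat_transpose[OF Sig(2)]] by simp_all
  ultimately show "psd_mat (matA Km Sigs Hm G i i + matC Sig Hm G i)"
    by (rule psd_mat_add)
  show "matA Km Sigs Hm G i i + matC Sig Hm G i \<in> carrier_mat (a * d) (a * d)"
    by (rule add_carrier_mat[OF c(2)])
qed

text \<open>Either alternative of the hypothesis makes the sum of the two covariances definite,
  since the other summand is semidefinite.\<close>

lemma pd_mat_matE:
  assumes X: "Km i * Sigs * mat_adjoint (Km i) \<in> carrier_mat a a" "psd_mat (Km i * Sigs * mat_adjoint (Km i))"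
    and Sig: "Sig i \<in> carrier_mat a a" "psd_mat (Sig i)"
    and pd: "pd_mat (Km i * Sigs * mat_adjoint (Km i)) \<or> pd_mat (Sig i)"
  shows "matE Km Sigs Sig N i \<in> carrier_mat (a * N i) (a * N i)" "pd_mat (matE Km Sigs Sig N i)"
proof -
  let ?X = "Km i * Sigs * mat_adjoint (Km i)"
  have "pd_mat (?X + Sig i)"
    using pd
  proof
    assume "pd_mat (Sig i)"
    then have "pd_mat (Sig i + ?X)"
      by (rule pd_mat_add_psd_mat[OF Sig(1) X(1) _ X(2)])
    then show ?thesis using comm_add_mat[OF Sig(1) X(1)] by simp
  qed (rule pd_mat_add_psd_mat[OF X(1) Sig(1) _ Sig(2)])
  then have pdT: "pd_mat (transpose_mat (?X + Sig i))" by (rule pd_mat_transpose)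
  have "?X + Sig i \<in> carrier_mat a a" by (rule add_carrier_mat[OF Sig(1)])
  then have T: "transpose_mat (?X + Sig i) \<in> carrier_mat a a" by (metis transpose_carrier_mat)
  show "matE Km Sigs Sig N i \<in> carrier_mat (a * N i) (a * N i)"
    unfolding matE_def by (rule kronecker_carrier[OF T one_carrier_mat])
  show "pd_mat (matE Km Sigs Sig N i)"
    unfolding matE_def by (rule pd_mat_kronecker_one[OF T pdT])
qed

lemma vecq_carrier:
  assumes "\<And>j. j \<in> {1..L} - {i} \<Longrightarrow> matA Km Sigs Hm G i j \<in> carrier_mat (J i * N i) (J j * N j)"
    and "\<And>j. j \<in> {1..L} - {i} \<Longrightarrow> f j \<in> carrier_vec (J j * N j)"
  shows "vecq L J N Km Sigs Hm G f i \<in> carrier_vec (J i * N i)"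
proof -
  interpret vec_space "TYPE(complex)" "J i * N i" .
  have "matA Km Sigs Hm G i j *\<^sub>v f j \<in> carrier_vec (J i * N i)" if "j \<in> {1..L} - {i}" for j
    using assms[OF that] by (rule mult_mat_vec_carrier)
  then show ?thesis
    unfolding vecq_def finsum_vec by (intro finsum_closed[simplified]) auto
qed

text \<open>Monotonicity makes the nonzero indices an initial segment, so their number is the
  0-based position of the first zero.\<close>

lemma card_nonzero_antimono:
  fixes lam :: "nat \<Rightarrow> real"
  assumes "\<And>k. k < n \<Longrightarrow> 0 \<le> lam k" "\<And>k l. k \<le> l \<Longrightarrow> l < n \<Longrightarrow> lam l \<le> lam k"
    and r: "r = card {k. k < n \<and> lam k \<noteq> 0}"
  shows "r \<le> n" "\<And>k. k < r \<Longrightarrow> 0 < lam k" "\<And>k. r \<le> k \<Longrightarrow> k < n \<Longrightarrow> lam k = 0"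
proof -
  let ?I = "{k. k < n \<and> lam k \<noteq> 0}"
  have fin: "finite ?I" by simp
  have down: "{..k} \<subseteq> ?I" if "k \<in> ?I" for k
  proof
    fix j assume "j \<in> {..k}"
    then show "j \<in> ?I"
      using that assms(1)[of k] assms(2)[of j k] by auto
  qed
  have up: "?I \<subseteq> {..<k}" if "k < n" "lam k = 0" for k
  proof
    fix j assume "j \<in> ?I"
    then show "j \<in> {..<k}"
      using that assms(1)[of j] assms(2)[of k j] by (cases "k \<le> j") auto
  qed
  show "r \<le> n" unfolding r using card_mono[of "{..<n}" ?I] by auto
  then show "0 < lam k" if "k < r" for k
    using that up[of k] card_mono[of "{..<k}" ?I] assms(1)[of k] unfolding r by force
  show "lam k = 0" if "r \<le> k" "k < n" for k
    using that down[of k] card_mono[OF fin, of "{..k}"] unfolding r by force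
qed

text \<open>With indices from 0, \<open>lam 0\<close> is the largest eigenvalue,
  \<open>lam (r - 1)\<close> the smallest positive one, and the tail starts at \<open>r\<close>. The
  equivalence for \<open>optimal\<close> expresses uniqueness in case (I), while case (II) exhibits
  one minimizer. \<open>U\<close> and \<open>Lam\<close> form an arbitrary eigendecomposition in
  decreasing order.\<close>

theorem theorem3:
  fixes L M K i :: nat
    and N J :: "nat \<Rightarrow> nat"
    and Km Hm Sig :: "nat \<Rightarrow> complex mat"
    and Sigs G :: "complex mat"
    and P :: "nat \<Rightarrow> real"
    and f :: "nat \<Rightarrow> complex vec"
    and n r :: nat
    and B Q E S Mi U Lam :: "complex mat"
    and g q p :: "complex vec"
    and lam :: "nat \<Rightarrow> real"
    and gi :: "real \<Rightarrow> real"
  assumes "L \<ge> 1" and "M \<ge> 1" and "K \<ge> 1"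
    and "\<And>j. j \<in> {1..L} \<Longrightarrow> N j \<ge> 1 \<and> J j \<ge> 1"
    and "\<And>j. j \<in> {1..L} \<Longrightarrow> Km j \<in> carrier_mat (J j) K"
    and "\<And>j. j \<in> {1..L} \<Longrightarrow> Hm j \<in> carrier_mat M (N j)"
    and "Sigs \<in> carrier_mat K K" and "psd_mat Sigs"
    and "\<And>j. j \<in> {1..L} \<Longrightarrow> Sig j \<in> carrier_mat (J j) (J j) \<and> psd_mat (Sig j)"
    and "\<And>j. j \<in> {1..L} \<Longrightarrow> P j > 0"
    and "i \<in> {1..L}"
    and "G \<in> carrier_mat M K"
    and "\<And>j. j \<in> {1..L} - {i} \<Longrightarrow> f j \<in> carrier_vec (J j * N j)"
    and "pd_mat (Km i * Sigs * mat_adjoint (Km i)) \<or> pd_mat (Sig i)"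
    and "n = J i * N i"
    and "g = vectorize G"
    and "B = matB Km Sigs Hm i"
    and "q = vecq L J N Km Sigs Hm G f i"
    and "Q = matA Km Sigs Hm G i i + matC Sig Hm G i"
    and "E = matE Km Sigs Sig N i"
    and "S = mat_inv (pd_sqrt E)"
    and "Mi = S * Q * S"
    and "U \<in> carrier_mat n n" and "unitary_mat U"
    and "Lam \<in> carrier_mat n n" and "diagonal_mat Lam"
    and "Mi = U * Lam * mat_adjoint U"
    and "\<And>k. lam k = Re (Lam $$ (k, k))"
    and "\<And>k l. k \<le> l \<Longrightarrow> l < n \<Longrightarrow> lam l \<le> lam k"
    and "r = vec_space.rank n Mi"
    and "p = mat_adjoint U *\<^sub>v (S *\<^sub>v (mat_adjoint B *\<^sub>v g - q))"
    and "\<And>\<mu>. gi \<mu> = (\<Sum>k<n. (cmod (p $ k))\<^sup>2 / (lam k + \<mu>)\<^sup>2)"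
  shows
    "let sub1 = (\<exists>k \<in> {r..<n}. cmod (p $ k) \<noteq> 0);
         sub2 = ((\<Sum>k=r..<n. cmod (p $ k)) = 0 \<and>
                 (\<Sum>k<r. (cmod (p $ k))\<^sup>2 / (lam k)\<^sup>2) > P i);
         pnorm = L2_set (\<lambda>k. cmod (p $ k)) {..<n};
         lbd = max 0 (pnorm / sqrt (P i) - lam 0);
         optimal = is_arg_min (P2_objective Q B q g) (P2_feasible E (P i))
     in
       (sub1 \<or> sub2 \<longrightarrow>
          (\<exists>!\<mu>. \<mu> > 0 \<and> gi \<mu> = P i) \<and>
          (\<forall>\<mu>. \<mu> > 0 \<and> gi \<mu> = P i \<longrightarrow>
             invertible_mat (Q + complex_of_real \<mu> \<cdot>\<^sub>m E) \<and>
             (\<forall>x. optimal x \<longleftrightarrow>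
                x = mat_inv (Q + complex_of_real \<mu> \<cdot>\<^sub>m E) *\<^sub>v (mat_adjoint B *\<^sub>v g - q)) \<and>
             (sub1 \<longrightarrow> \<mu> \<in> {lbd..pnorm / sqrt (P i)}) \<and>
             (sub2 \<longrightarrow> \<mu> \<in> {lbd..pnorm / sqrt (P i) - lam (r - 1)}))) \<and>
       ((\<Sum>k=r..<n. cmod (p $ k)) = 0 \<and>
        (\<Sum>k<r. (cmod (p $ k))\<^sup>2 / (lam k)\<^sup>2) \<le> P i \<longrightarrow>
          optimal (S *\<^sub>v (pinv Mi *\<^sub>v (S *\<^sub>v (mat_adjoint B *\<^sub>v g - q)))))"
proof -
  note Km = assms(5) and Hm = assms(6) and Sigs = assms(7,8) and Sig = assms(9)
    and P = assms(10)[OF assms(11)] and i = assms(11) and G = assms(12) and f = assms(13) and pd = assms(14)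
    and n = assms(15) and U = assms(23) and Lam = assms(25,26,27) and lam = assms(28) and mono = assms(29)
    and p = assms(31) and gi = assms(32)
  have Ki: "Km i \<in> carrier_mat (J i) K" and Hi: "Hm i \<in> carrier_mat M (N i)"
    and Sigi: "Sig i \<in> carrier_mat (J i) (J i)" "psd_mat (Sig i)"
    using Km Hm Sig i by auto
  have Kij: "Km j * Sigs * mat_adjoint (Km i) \<in> carrier_mat (J j) (J i)" if "j \<in> {1..L}" for j
    by (intro mult_carrier_mat[of _ _ K]) (use Km[OF that] Ki Sigs in auto)
  have X: "Km i * Sigs * mat_adjoint (Km i) \<in> carrier_mat (J i) (J i)" by (rule Kij[OF i])
  have psdX: "psd_mat (Km i * Sigs * mat_adjoint (Km i))"
    using psd_mat_congruence[of Sigs K "mat_adjoint (Km i)" "J i"] Sigs Ki by simp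
  have Q: "Q \<in> carrier_mat n n" "psd_mat Q"
    using psd_matA_add_matC[where Km = Km and Sig = Sig and Hm = Hm, OF X psdX Sigi Hi G] by (auto simp: n assms(19))
  have E: "E \<in> carrier_mat n n" "pd_mat E"
    using pd_mat_matE[where Km = Km and Sig = Sig, OF X psdX Sigi pd] by (auto simp: n assms(20))
  have q: "q \<in> carrier_vec n"
    unfolding n assms(18)
  proof (rule vecq_carrier[OF _ f])
    fix j assume j: "j \<in> {1..L} - {i}"
    have "mat_adjoint (Hm i) * G * mat_adjoint G * Hm j \<in> carrier_mat (N i) (N j)"
      by (intro mult_carrier_mat[of _ _ M] mult_carrier_mat[of _ _ K]) (use Hm[of j] Hi G j in auto)
    moreover have "transpose_mat (Km j * Sigs * mat_adjoint (Km i)) \<in> carrier_mat (J i) (J j)"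
      using Kij[of j] j by (metis DiffD1 transpose_carrier_mat)
    ultimately show "matA Km Sigs Hm G i j \<in> carrier_mat (J i * N i) (J j * N j)"
      unfolding matA_def by (intro kronecker_carrier)
  qed
  have B: "B \<in> carrier_mat (K * M) n"
    unfolding n assms(17) matB_def
    by (intro kronecker_carrier transpose_carrier_mat[THEN iffD2] mult_carrier_mat[of _ _ K]) (use Ki Sigs Hi in auto)
  have g: "g \<in> carrier_vec (K * M)"
    using G by (auto simp: assms(16) vectorize_def mult.commute)
  define b where "b = mat_adjoint B *\<^sub>v g - q"
  have b: "b \<in> carrier_vec n"
    unfolding b_def using B g q by (meson mat_adjoint_carrier minus_carrier_vec mult_mat_vec_carrier)

  note R = pd_sqrt[OF E] and S = mat_inv_pd_sqrt[OF E, folded assms(21)]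
  note assoc = assoc_mult_mat[of _ n n _ n _ n]
  have cc: "X * Y \<in> carrier_mat n n" if "X \<in> carrier_mat n n" "Y \<in> carrier_mat n n" for X Y :: "complex mat"
    using that by (rule mult_carrier_mat)
  have UU: "mat_adjoint U * U = 1\<^sub>m n" "U * mat_adjoint U = 1\<^sub>m n"
    using assms(24) U by (auto simp: unitary_mat_def inverts_mat_def)
  have U': "mat_adjoint U \<in> carrier_mat n n" using U by simp
  have Sh: "mat_adjoint S = S" using S(2) by (simp add: hermitian_mat_def)
  have Mi: "Mi \<in> carrier_mat n n" "psd_mat Mi"
    using psd_mat_congruence[OF Q(1) S(1) Q(2)] Q(1) S(1) by (auto simp: assms(22) Sh cc)
  have "mat_adjoint U * Mi * U = Lam"
    by (rule unitary_conjugation_inverse[OF U UU(1) Lam(1,3)])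
  then have psdLam: "psd_mat Lam"
    using psd_mat_congruence[OF Mi(1) U Mi(2)] by simp
  \<comment> \<open>\<open>lam\<close> only records real parts; \<open>Lam\<close> is Hermitian, so
    nothing is lost.\<close>
  have LamR: "Lam $$ (k, k) = complex_of_real (lam k)" if "k < n" for k
    using hermitian_mat_index[of Lam k k] psdLam Lam(1) that by (simp add: lam complex_eq_iff psd_mat_def)
  have LamD: "Lam = mat_diag n (\<lambda>k. complex_of_real (lam k))"
    using LamR Lam(1,2) by (intro eq_matI) (auto simp: mat_diag_def diagonal_mat_def)
  have lam0: "0 \<le> lam k" if "k < n" for k
  proof -
    have "0 \<le> Re (conjugate (unit_vec n k) \<bullet> (Lam *\<^sub>v unit_vec n k))"
      using psdLam Lam(1) unfolding psd_mat_def by (metis carrier_matD(1) unit_vec_carrier)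
    also have "\<dots> = (\<Sum>j<n. lam j * (cmod (unit_vec n k $ j))\<^sup>2)"
      unfolding LamD by (rule Re_quadratic_form_mat_diag) simp
    also have "\<dots> = (\<Sum>j<n. if j = k then lam k else 0)"
      by (intro sum.cong) (auto simp: unit_vec_def)
    also have "\<dots> = lam k" using that by simp
    finally show ?thesis .
  qed
  have MiD: "Mi = U * mat_diag n (\<lambda>k. complex_of_real (lam k)) * mat_adjoint U"
    using Lam(3) LamD by simp
  have rc: "r = card {k. k < n \<and> lam k \<noteq> 0}"
    using rank_unitary_diagonal[OF U UU(1), of "\<lambda>k. complex_of_real (lam k)"] by (simp add: assms(30) MiD)
  have r: "r \<le> n" "\<And>k. k < r \<Longrightarrow> 0 < lam k" "\<And>k. r \<le> k \<Longrightarrow> k < n \<Longrightarrow> lam k = 0"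
    using card_nonzero_antimono[of n lam r] lam0 mono rc by blast+

  define T where "T = S * U"
  \<comment> \<open>The inverse of \<open>T\<close>, since \<open>U\<close> is unitary and
    \<open>S\<close> inverts the root.\<close>
  define T' where "T' = mat_adjoint U * pd_sqrt E"
  have T: "T \<in> carrier_mat n n" "T' \<in> carrier_mat n n" using U U' S(1) R(1) by (simp_all add: T_def T'_def cc)
  have Tadj: "mat_adjoint T = mat_adjoint U * S"
    unfolding T_def using mat_adjoint_mult[OF S(1) U] Sh by simp
  have pT: "p = mat_adjoint T *\<^sub>v b"
    unfolding p Tadj b_def[symmetric] by (rule assoc_mult_mat_vec[of _ n n _ n, symmetric]) (use U' S b in auto)
  interpret simultaneous_diagonalization n T T' Q E lam b p
  proof
    have "T * T' = S * (U * mat_adjoint U) * pd_sqrt E"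
      using U U' S(1) R(1) by (simp add: T_def T'_def assoc cc)
    then show "T * T' = 1\<^sub>m n" using UU S by simp
    have "mat_adjoint T * Q * T = mat_adjoint U * (S * Q * S) * U"
      unfolding Tadj using U U' S(1) Q(1) by (simp add: T_def assoc cc)
    then show "mat_adjoint T * Q * T = mat_diag n (\<lambda>k. complex_of_real (lam k))"
      using \<open>mat_adjoint U * Mi * U = Lam\<close> LamD by (simp add: assms(22))
    have "mat_adjoint T * (pd_sqrt E * pd_sqrt E) * T = mat_adjoint U * (S * pd_sqrt E) * (pd_sqrt E * S) * U"
      unfolding Tadj using U U' S(1) R(1) by (simp add: T_def assoc cc)
    also have "\<dots> = 1\<^sub>m n"
      unfolding S(3,4) using U U' UU by (simp add: cc)
    finally show "mat_adjoint T * E * T = 1\<^sub>m n" unfolding R(3) .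
  qed (use T Q E b pT lam0 in simp_all)

  have obj: "P2_objective Q B q g x = Re (conjugate x \<bullet> (Q *\<^sub>v x)) - 2 * Re (conjugate b \<bullet> x)"
    if "x \<in> carrier_vec n" for x
    unfolding b_def by (rule P2_objective_eq[OF B q g that])
  let ?c = "\<lambda>k. cmod (p $ k)"
  let ?L = "L2_set ?c {..<n}"
  let ?optimal = "is_arg_min (P2_objective Q B q g) (P2_feasible E (P i))"
  let ?sub1 = "\<exists>k\<in>{r..<n}. ?c k \<noteq> 0"
  let ?sub2 = "(\<Sum>k=r..<n. ?c k) = 0 \<and> (\<Sum>k<r. (?c k)\<^sup>2 / (lam k)\<^sup>2) > P i"
  have tail: "(\<Sum>k=r..<n. ?c k) = 0 \<longleftrightarrow> (\<forall>k\<in>{r..<n}. ?c k = 0)"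
    by (subst sum_nonneg_eq_0_iff) auto

  have "\<exists>!\<mu>. \<mu> > 0 \<and> gi \<mu> = P i" if "?sub1 \<or> ?sub2"
    unfolding gi by (rule secular_root_exists[OF P r(1) r(2,3)]) (use that tail in auto)
  moreover have "invertible_mat (Q + complex_of_real \<mu> \<cdot>\<^sub>m E)"
    "?optimal x \<longleftrightarrow> x = mat_inv (Q + complex_of_real \<mu> \<cdot>\<^sub>m E) *\<^sub>v b"
    if "\<mu> > 0" "gi \<mu> = P i" for \<mu> x
    using shifted_inverse[OF that(1)] is_arg_min_active[of "P2_objective Q B q g", OF obj that(1)] that(2)
    unfolding gi by simp_all
  moreover have "max 0 (?L / sqrt (P i) - lam 0) \<le> \<mu>" "\<mu> \<le> ?L / sqrt (P i)"
    "?sub2 \<Longrightarrow> \<mu> \<le> ?L / sqrt (P i) - lam (r - 1)"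
    if \<mu>: "\<mu> > 0" "gi \<mu> = P i" for \<mu>
  proof -
    \<comment> \<open>The value \<open>l\<close> is left open: 0 gives the general upper bound and
      \<open>lam (r - 1)\<close> the sharper one of subcase ii).\<close>
    have bounds: "?L / sqrt (P i) - lam 0 \<le> \<mu>" "\<mu> \<le> ?L / sqrt (P i) - l"
      if "\<And>k. k < n \<Longrightarrow> ?c k \<noteq> 0 \<Longrightarrow> l \<le> lam k" "0 \<le> l" for l
      using secular_root_bounds[where P = "P i" and n = n and c = ?c and lam = lam and u = "lam 0" and l = l] P \<mu>(1) \<mu>(2)[unfolded gi] lam0 mono[of 0] that
      by blast+
    show "max 0 (?L / sqrt (P i) - lam 0) \<le> \<mu>"
      using bounds(1)[of 0] lam0 \<mu> by auto
    show "\<mu> \<le> ?L / sqrt (P i)"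
      using bounds(2)[of 0] lam0 by auto
    assume sub2: ?sub2
    \<comment> \<open>An empty sum cannot exceed the positive \<open>P i\<close>, so
      \<open>r - 1\<close> is a genuine predecessor.\<close>
    then have "r \<noteq> 0" using P by (intro notI) auto
    then have r1: "r - 1 < r" "r - 1 < n" using r(1) by auto
    show "\<mu> \<le> ?L / sqrt (P i) - lam (r - 1)"
    proof (rule bounds(2))
      fix k assume "k < n" "?c k \<noteq> 0"
      then have "k < r" using sub2 tail by (metis atLeastLessThan_iff not_less)
      then show "lam (r - 1) \<le> lam k" using mono[of k "r - 1"] r1 by simp
    qed (use r(2)[OF r1(1)] in simp_all)
  qed
  moreover have "?optimal (S *\<^sub>v (pinv Mi *\<^sub>v (S *\<^sub>v b)))"
    if 0: "(\<Sum>k=r..<n. ?c k) = 0" and le: "(\<Sum>k<r. (?c k)\<^sup>2 / (lam k)\<^sup>2) \<le> P i"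
  proof -
    let ?D = "mat_diag n (\<lambda>k. complex_of_real (inverse (lam k)))"
    have c: "S *\<^sub>v b \<in> carrier_vec n" using S(1) b by (rule mult_mat_vec_carrier)
    \<comment> \<open>The pseudoinverse is diagonal in the same eigenbasis, so \<open>p\<close> and
      \<open>T\<close> reappear and the formula becomes \<open>T\<close> applied to the
      coordinatewise minimizer.\<close>
    have "pinv Mi *\<^sub>v (S *\<^sub>v b) = (U * ?D) *\<^sub>v (mat_adjoint U *\<^sub>v (S *\<^sub>v b))"
      unfolding pinv_unitary_diagonal[OF U UU(1) MiD]
      by (rule assoc_mult_mat_vec[of _ n n _ n]) (use U U' c cc in auto)
    also have "mat_adjoint U *\<^sub>v (S *\<^sub>v b) = p" unfolding assms(31) b_def ..
    also have "(U * ?D) *\<^sub>v p = U *\<^sub>v (?D *\<^sub>v p)"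
      by (rule assoc_mult_mat_vec[of _ n n _ n]) (use U p_carrier in auto)
    also have "S *\<^sub>v \<dots> = T *\<^sub>v (?D *\<^sub>v p)"
      unfolding T_def
      by (rule assoc_mult_mat_vec[of _ n n _ n, symmetric]) (use U S(1) p_carrier in \<open>auto simp: mat_diag_mult_vec\<close>)
    also have "?D *\<^sub>v p = vec n (\<lambda>k. complex_of_real (inverse (lam k)) * p $ k)"
      by (rule mat_diag_mult_vec[OF p_carrier])
    finally have eq: "S *\<^sub>v (pinv Mi *\<^sub>v (S *\<^sub>v b)) = T *\<^sub>v vec n (\<lambda>k. complex_of_real (inverse (lam k)) * p $ k)" .
    show ?thesis
      unfolding eq
    proof (rule is_arg_min_inactive[OF obj])
      show "p $ k = 0" if "k < n" "lam k = 0" for k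
        using that r(2)[of k] 0 tail by (cases "k < r") auto
      \<comment> \<open>From \<open>r\<close> on the eigenvalues are 0, and division by 0 yields
        0.\<close>
      have "(\<Sum>k<n. (?c k)\<^sup>2 / (lam k)\<^sup>2) = (\<Sum>k<r. (?c k)\<^sup>2 / (lam k)\<^sup>2)"
        using r(1,3) by (intro sum.mono_neutral_right) (auto simp: not_less)
      then show "(\<Sum>k<n. (?c k)\<^sup>2 / (lam k)\<^sup>2) \<le> P i" using le by simp
    qed
  qed
  ultimately show ?thesis
    unfolding Let_def b_def[symmetric] by (auto simp del: max.bounded_iff)
qed

end
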